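(* Let $\mathcal{X},\mathcal{Y},\mathcal{Z}$ be length abelian categories and let $R(\mathcal{Y},\mathcal{X},\mathcal{Z})$ be a recollement of $\mathcal{X}$ relative to $\mathcal{Y}$ and $\mathcal{Z}$, with functors $i^{*},i^{!}:\mathcal{X}\to\mathcal{Y}$, $i_{*}:\mathcal{Y}\to\mathcal{X}$, $j^{*}:\mathcal{X}\to\mathcal{Z}$, $j_{!},j_{*}:\mathcal{Z}\to\mathcal{X}$. Let $\mathcal{M}_{\mathcal{Y}}$ be a cofinally closed monobrick in $\mathcal{Y}$ and $\mathcal{M}_{\mathcal{Z}}$ a cofinally closed monobrick in $\mathcal{Z}$. If $i^{!}$ is exact, then $$\mathcal{M}_{\mathcal{X}}:=i_{*}(\mathcal{M}_{\mathcal{Y}})\sqcup j_{*}(\mathcal{M}_{\mathcal{Z}})$$ is a cofinally closed monobrick in $\mathcal{X}$.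
   Context: A length abelian category is an abelian category in which every object has finite length. Recollement: for abelian categories $\mathcal{X},\mathcal{Y},\mathcal{Z}$, a recollement of $\mathcal{X}$ relative to $\mathcal{Y}$ and $\mathcal{Z}$ consists of functors $i^{*},i^{!}:\mathcal{X}\to\mathcal{Y}$, $i_{*}:\mathcal{Y}\to\mathcal{X}$, $j^{*}:\mathcal{X}\to\mathcal{Z}$, $j_{!},j_{*}:\mathcal{Z}\to\mathcal{X}$ such that: (a) $(i^{*},i_{*})$, $(i_{*},i^{!})$, $(j_{!},j^{*})$, $(j^{*},j_{*})$ are adjoint pairs (left adjoint written first); (b) $i_{*},j_{!},j_{*}$ are fully faithful; (c) $\operatorname{Im} i_{*}=\operatorname{Ker} j^{*}$ (the essential image of $i_*$ is the full subcategory of objects $X$ with $j^{*}X=0$). Let $\mathcal{A}$ be a length abelian category. An object $S\in\mathcal{A}$ is a brick if $\operatorname{End}_{\mathcal{A}}(S)$ is a division ring. A set $\mathcal{M}$ of isomorphism classes of bricks in $\mathcal{A}$ is a monobrick if for all $S_1,S_2\in\mathcal{M}$ every morphism $S_1\to S_2$ is either zero or an injection (monomorphism). A monobrick $\mathcal{M}$ is cofinally closed if: whenever there is an injection $N\hookrightarrow M$ with $N$ a brick, $N\notin\mathcal{M}$ and $M\in\mathcal{M}$, there is a non-zero non-injective morphism $N\to M'$ for some $M'\in\mathcal{M}$. *)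

theory Defs
  imports "HOL-Algebra.Ring"
begin

section \<open>Abelian categories\<close>

text \<open>
  Categories have a set of objects and a set of arrows inside arbitrary types. The composite
  \<^term>\<open>comp C g f\<close> means ``first f, then g'' and is meaningful only if the codomain of
  f is the domain of g. An additive structure on the hom-sets is part of the data; sums are
  meaningful for parallel arrows only.
\<close>

record ('o, 'm) cat =
  Obj :: "'o set"
  Arr :: "'m set"
  Dom :: "'m \<Rightarrow> 'o"
  Cod :: "'m \<Rightarrow> 'o"
  idt :: "'o \<Rightarrow> 'm"
  comp :: "'m \<Rightarrow> 'm \<Rightarrow> 'm" (infixl "\<bullet>\<index>" 70)

record ('o, 'm) add_cat = "('o, 'm) cat" +
  plus_arr :: "'m \<Rightarrow> 'm \<Rightarrow> 'm"
  zero_arr :: "'o \<Rightarrow> 'o \<Rightarrow> 'm"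

definition Homs :: "('o, 'm, 'x) cat_scheme \<Rightarrow> 'o \<Rightarrow> 'o \<Rightarrow> 'm set" where
  "Homs C X Y = {f \<in> Arr C. Dom C f = X \<and> Cod C f = Y}"

locale category =
  fixes C :: "('o, 'm, 'x) cat_scheme" (structure)
  assumes Dom_in_Obj: "f \<in> Arr C \<Longrightarrow> Dom C f \<in> Obj C"
    and Cod_in_Obj: "f \<in> Arr C \<Longrightarrow> Cod C f \<in> Obj C"
    and idt_in_Homs: "X \<in> Obj C \<Longrightarrow> idt C X \<in> Homs C X X"
    and comp_in_Homs: "\<lbrakk>f \<in> Homs C X Y; g \<in> Homs C Y Z\<rbrakk> \<Longrightarrow> g \<bullet> f \<in> Homs C X Z"
    and comp_idt_right: "f \<in> Homs C X Y \<Longrightarrow> f \<bullet> idt C X = f"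
    and comp_idt_left: "f \<in> Homs C X Y \<Longrightarrow> idt C Y \<bullet> f = f"
    and comp_assoc: "\<lbrakk>f \<in> Homs C W X; g \<in> Homs C X Y; h \<in> Homs C Y Z\<rbrakk>
      \<Longrightarrow> (h \<bullet> g) \<bullet> f = h \<bullet> (g \<bullet> f)"

definition is_mono :: "('o, 'm, 'x) cat_scheme \<Rightarrow> 'm \<Rightarrow> bool" where
  "is_mono C f \<longleftrightarrow> f \<in> Arr C \<and>
    (\<forall>W. \<forall>g \<in> Homs C W (Dom C f). \<forall>h \<in> Homs C W (Dom C f).
      f \<bullet>\<^bsub>C\<^esub> g = f \<bullet>\<^bsub>C\<^esub> h \<longrightarrow> g = h)"

definition is_epi :: "('o, 'm, 'x) cat_scheme \<Rightarrow> 'm \<Rightarrow> bool" where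
  "is_epi C f \<longleftrightarrow> f \<in> Arr C \<and>
    (\<forall>W. \<forall>g \<in> Homs C (Cod C f) W. \<forall>h \<in> Homs C (Cod C f) W.
      g \<bullet>\<^bsub>C\<^esub> f = h \<bullet>\<^bsub>C\<^esub> f \<longrightarrow> g = h)"

definition is_isomorphism :: "('o, 'm, 'x) cat_scheme \<Rightarrow> 'm \<Rightarrow> bool" where
  "is_isomorphism C f \<longleftrightarrow> f \<in> Arr C \<and>
    (\<exists>g \<in> Homs C (Cod C f) (Dom C f).
      g \<bullet>\<^bsub>C\<^esub> f = idt C (Dom C f) \<and> f \<bullet>\<^bsub>C\<^esub> g = idt C (Cod C f))"

definition isomorphic :: "('o, 'm, 'x) cat_scheme \<Rightarrow> 'o \<Rightarrow> 'o \<Rightarrow> bool" where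
  "isomorphic C X Y \<longleftrightarrow> (\<exists>f \<in> Homs C X Y. is_isomorphism C f)"

definition is_zero_object :: "('o, 'm, 'x) cat_scheme \<Rightarrow> 'o \<Rightarrow> bool" where
  "is_zero_object C Z \<longleftrightarrow> Z \<in> Obj C \<and>
    (\<forall>X \<in> Obj C. (\<exists>!f. f \<in> Homs C X Z) \<and> (\<exists>!f. f \<in> Homs C Z X))"

definition hom_group :: "('o, 'm, 'x) add_cat_scheme \<Rightarrow> 'o \<Rightarrow> 'o \<Rightarrow> 'm monoid" where
  "hom_group C X Y = \<lparr>carrier = Homs C X Y, mult = plus_arr C, one = zero_arr C X Y\<rparr>"

locale preadditive_category = category C for C :: "('o, 'm, 'x) add_cat_scheme" (structure) +
  assumes comm_group_hom_group:
      "\<lbrakk>X \<in> Obj C; Y \<in> Obj C\<rbrakk> \<Longrightarrow> comm_group (hom_group C X Y)"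
    and comp_plus_right: "\<lbrakk>f \<in> Homs C X Y; f' \<in> Homs C X Y; g \<in> Homs C Y Z\<rbrakk>
      \<Longrightarrow> g \<bullet> plus_arr C f f' = plus_arr C (g \<bullet> f) (g \<bullet> f')"
    and comp_plus_left: "\<lbrakk>f \<in> Homs C X Y; g \<in> Homs C Y Z; g' \<in> Homs C Y Z\<rbrakk>
      \<Longrightarrow> plus_arr C g g' \<bullet> f = plus_arr C (g \<bullet> f) (g' \<bullet> f)"

definition has_biproduct :: "('o, 'm, 'x) add_cat_scheme \<Rightarrow> 'o \<Rightarrow> 'o \<Rightarrow> bool" where
  "has_biproduct C X Y \<longleftrightarrow>
    (\<exists>P \<in> Obj C. \<exists>inX \<in> Homs C X P. \<exists>inY \<in> Homs C Y P. \<exists>prX \<in> Homs C P X. \<exists>prY \<in> Homs C P Y.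
      prX \<bullet>\<^bsub>C\<^esub> inX = idt C X \<and> prY \<bullet>\<^bsub>C\<^esub> inY = idt C Y \<and>
      prX \<bullet>\<^bsub>C\<^esub> inY = zero_arr C Y X \<and> prY \<bullet>\<^bsub>C\<^esub> inX = zero_arr C X Y \<and>
      plus_arr C (inX \<bullet>\<^bsub>C\<^esub> prX) (inY \<bullet>\<^bsub>C\<^esub> prY) = idt C P)"

definition is_kernel :: "('o, 'm, 'x) add_cat_scheme \<Rightarrow> 'm \<Rightarrow> 'm \<Rightarrow> bool" where
  "is_kernel C f k \<longleftrightarrow> f \<in> Arr C \<and> k \<in> Arr C \<and> Cod C k = Dom C f \<and>
    f \<bullet>\<^bsub>C\<^esub> k = zero_arr C (Dom C k) (Cod C f) \<and>
    (\<forall>W. \<forall>g \<in> Homs C W (Dom C f). f \<bullet>\<^bsub>C\<^esub> g = zero_arr C W (Cod C f) \<longrightarrow>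
      (\<exists>!u. u \<in> Homs C W (Dom C k) \<and> k \<bullet>\<^bsub>C\<^esub> u = g))"

definition is_cokernel :: "('o, 'm, 'x) add_cat_scheme \<Rightarrow> 'm \<Rightarrow> 'm \<Rightarrow> bool" where
  "is_cokernel C f q \<longleftrightarrow> f \<in> Arr C \<and> q \<in> Arr C \<and> Dom C q = Cod C f \<and>
    q \<bullet>\<^bsub>C\<^esub> f = zero_arr C (Dom C f) (Cod C q) \<and>
    (\<forall>W. \<forall>g \<in> Homs C (Cod C f) W. g \<bullet>\<^bsub>C\<^esub> f = zero_arr C (Dom C f) W \<longrightarrow>
      (\<exists>!u. u \<in> Homs C (Cod C q) W \<and> u \<bullet>\<^bsub>C\<^esub> q = g))"

locale abelian_category = preadditive_category C
  for C :: "('o, 'm, 'x) add_cat_scheme" (structure) +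
  assumes ex_zero_object: "\<exists>Z. is_zero_object C Z"
    and ex_biproduct: "\<lbrakk>X \<in> Obj C; Y \<in> Obj C\<rbrakk> \<Longrightarrow> has_biproduct C X Y"
    and ex_kernel: "f \<in> Arr C \<Longrightarrow> \<exists>k. is_kernel C f k"
    and ex_cokernel: "f \<in> Arr C \<Longrightarrow> \<exists>q. is_cokernel C f q"
    and mono_is_kernel: "is_mono C f \<Longrightarrow> \<exists>g. is_kernel C g f"
    and epi_is_cokernel: "is_epi C f \<Longrightarrow> \<exists>g. is_cokernel C g f"

definition is_simple_object :: "('o, 'm, 'x) cat_scheme \<Rightarrow> 'o \<Rightarrow> bool" where
  "is_simple_object C S \<longleftrightarrow> S \<in> Obj C \<and> \<not> is_zero_object C S \<and>
    (\<forall>f. is_mono C f \<and> Cod C f = S \<longrightarrow> is_zero_object C (Dom C f) \<or> is_isomorphism C f)"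

text \<open>
  An object has finite length if it has a composition series: monomorphisms
  \<^term>\<open>\<iota> i\<close> from \<^term>\<open>F i\<close> to \<^term>\<open>F (Suc i)\<close>, for \<^prop>\<open>i < n\<close>, with simple cokernels,
  starting at a zero object and ending at the given object.
\<close>

definition has_finite_length :: "('o, 'm, 'x) add_cat_scheme \<Rightarrow> 'o \<Rightarrow> bool" where
  "has_finite_length C X \<longleftrightarrow>
    (\<exists>n F \<iota>. is_zero_object C (F 0) \<and> F n = X \<and>
      (\<forall>i<n. \<iota> i \<in> Homs C (F i) (F (Suc i)) \<and> is_mono C (\<iota> i) \<and>
        (\<exists>q. is_cokernel C (\<iota> i) q \<and> is_simple_object C (Cod C q))))"

locale length_abelian_category = abelian_category C
  for C :: "('o, 'm, 'x) add_cat_scheme" (structure) +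
  assumes finite_length: "X \<in> Obj C \<Longrightarrow> has_finite_length C X"


section \<open>Functors and recollements\<close>

record ('o1, 'm1, 'o2, 'm2) funct =
  on_obj :: "'o1 \<Rightarrow> 'o2"
  on_arr :: "'m1 \<Rightarrow> 'm2"

definition is_functor :: "('o1, 'm1, 'x1) cat_scheme \<Rightarrow> ('o2, 'm2, 'x2) cat_scheme \<Rightarrow>
    ('o1, 'm1, 'o2, 'm2) funct \<Rightarrow> bool" where
  "is_functor C D F \<longleftrightarrow>
    (\<forall>X \<in> Obj C. on_obj F X \<in> Obj D) \<and>
    (\<forall>X Y. \<forall>f \<in> Homs C X Y. on_arr F f \<in> Homs D (on_obj F X) (on_obj F Y)) \<and>
    (\<forall>X \<in> Obj C. on_arr F (idt C X) = idt D (on_obj F X)) \<and>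
    (\<forall>X Y Z. \<forall>f \<in> Homs C X Y. \<forall>g \<in> Homs C Y Z.
      on_arr F (g \<bullet>\<^bsub>C\<^esub> f) = on_arr F g \<bullet>\<^bsub>D\<^esub> on_arr F f)"

definition fully_faithful :: "('o1, 'm1, 'x1) cat_scheme \<Rightarrow> ('o2, 'm2, 'x2) cat_scheme \<Rightarrow>
    ('o1, 'm1, 'o2, 'm2) funct \<Rightarrow> bool" where
  "fully_faithful C D F \<longleftrightarrow>
    (\<forall>X \<in> Obj C. \<forall>Y \<in> Obj C.
      bij_betw (on_arr F) (Homs C X Y) (Homs D (on_obj F X) (on_obj F Y)))"

text \<open>
  \<^term>\<open>adjoint_pair C D F G\<close>: the functor F from C to D is left adjoint to G, via bijections
  \<^term>\<open>\<phi> X Y\<close> from \<^term>\<open>Homs D (on_obj F X) Y\<close> onto \<^term>\<open>Homs C X (on_obj G Y)\<close> natural in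
  both arguments.
\<close>

definition adjoint_pair :: "('o1, 'm1, 'x1) cat_scheme \<Rightarrow> ('o2, 'm2, 'x2) cat_scheme \<Rightarrow>
    ('o1, 'm1, 'o2, 'm2) funct \<Rightarrow> ('o2, 'm2, 'o1, 'm1) funct \<Rightarrow> bool" where
  "adjoint_pair C D F G \<longleftrightarrow> is_functor C D F \<and> is_functor D C G \<and>
    (\<exists>\<phi>.
      (\<forall>X \<in> Obj C. \<forall>Y \<in> Obj D.
        bij_betw (\<phi> X Y) (Homs D (on_obj F X) Y) (Homs C X (on_obj G Y))) \<and>
      (\<forall>X' X Y Y'. \<forall>f \<in> Homs C X' X. \<forall>g \<in> Homs D (on_obj F X) Y. \<forall>h \<in> Homs D Y Y'.
        \<phi> X' Y' (h \<bullet>\<^bsub>D\<^esub> (g \<bullet>\<^bsub>D\<^esub> on_arr F f)) = on_arr G h \<bullet>\<^bsub>C\<^esub> (\<phi> X Y g \<bullet>\<^bsub>C\<^esub> f)))"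

text \<open>
  The short exact sequences are the pairs \<^term>\<open>(f, g)\<close> such that f is a kernel of g and g is a
  cokernel of f.
\<close>

definition short_exact :: "('o, 'm, 'x) add_cat_scheme \<Rightarrow> 'm \<Rightarrow> 'm \<Rightarrow> bool" where
  "short_exact C f g \<longleftrightarrow> is_kernel C g f \<and> is_cokernel C f g"

definition exact_functor :: "('o1, 'm1, 'x1) add_cat_scheme \<Rightarrow> ('o2, 'm2, 'x2) add_cat_scheme \<Rightarrow>
    ('o1, 'm1, 'o2, 'm2) funct \<Rightarrow> bool" where
  "exact_functor C D F \<longleftrightarrow> is_functor C D F \<and>
    (\<forall>f g. short_exact C f g \<longrightarrow> short_exact D (on_arr F f) (on_arr F g))"

text \<open>
  The functors \<open>i_ust, i_lst, i_ush, j_lsh, j_ust, j_lst\<close> are usually written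
  \<open>i\<^sup>*\<close>, \<open>i\<^sub>*\<close>, \<open>i\<^sup>!\<close>, \<open>j\<^sub>!\<close>, \<open>j\<^sup>*\<close>, \<open>j\<^sub>*\<close>. Additivity is not assumed: between abelian categories
  it follows from the adjunctions.
\<close>

locale recollement =
  Y: abelian_category Y + X: abelian_category X + Z: abelian_category Z
  for Y :: "('oy, 'my, 'ey) add_cat_scheme"
    and X :: "('ox, 'mx, 'ex) add_cat_scheme"
    and Z :: "('oz, 'mz, 'ez) add_cat_scheme" +
  fixes i_ust :: "('ox, 'mx, 'oy, 'my) funct"
    and i_lst :: "('oy, 'my, 'ox, 'mx) funct"
    and i_ush :: "('ox, 'mx, 'oy, 'my) funct"
    and j_lsh :: "('oz, 'mz, 'ox, 'mx) funct"
    and j_ust :: "('ox, 'mx, 'oz, 'mz) funct"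
    and j_lst :: "('oz, 'mz, 'ox, 'mx) funct"
  assumes adj_i_ust_i_lst: "adjoint_pair X Y i_ust i_lst"
    and adj_i_lst_i_ush: "adjoint_pair Y X i_lst i_ush"
    and adj_j_lsh_j_ust: "adjoint_pair Z X j_lsh j_ust"
    and adj_j_ust_j_lst: "adjoint_pair X Z j_ust j_lst"
    and ff_i_lst: "fully_faithful Y X i_lst"
    and ff_j_lsh: "fully_faithful Z X j_lsh"
    and ff_j_lst: "fully_faithful Z X j_lst"
    and image_eq_kernel:
      "{B \<in> Obj X. \<exists>A \<in> Obj Y. isomorphic X B (on_obj i_lst A)}
        = {B \<in> Obj X. is_zero_object Z (on_obj j_ust B)}"


section \<open>Bricks and monobricks\<close>

definition End_ring :: "('o, 'm, 'x) add_cat_scheme \<Rightarrow> 'o \<Rightarrow> 'm ring" where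
  "End_ring C S = \<lparr>carrier = Homs C S S, mult = comp C, one = idt C S,
    zero = zero_arr C S S, add = plus_arr C\<rparr>"

definition is_division_ring :: "('a, 'r) ring_scheme \<Rightarrow> bool" where
  "is_division_ring R \<longleftrightarrow> ring R \<and> \<one>\<^bsub>R\<^esub> \<noteq> \<zero>\<^bsub>R\<^esub> \<and> Units R = carrier R - {\<zero>\<^bsub>R\<^esub>}"

definition is_brick :: "('o, 'm, 'x) add_cat_scheme \<Rightarrow> 'o \<Rightarrow> bool" where
  "is_brick C S \<longleftrightarrow> S \<in> Obj C \<and> is_division_ring (End_ring C S)"

definition iso_class :: "('o, 'm, 'x) cat_scheme \<Rightarrow> 'o \<Rightarrow> 'o set" where
  "iso_class C X = {Y \<in> Obj C. isomorphic C X Y}"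

text \<open>
  A set of isomorphism classes of objects is a set of sets of objects, so its members are
  referred to through representatives.
\<close>

definition monobrick :: "('o, 'm, 'x) add_cat_scheme \<Rightarrow> 'o set set \<Rightarrow> bool" where
  "monobrick C \<M> \<longleftrightarrow> \<M> \<subseteq> {iso_class C S | S. is_brick C S} \<and>
    (\<forall>S\<^sub>1 \<in> Obj C. \<forall>S\<^sub>2 \<in> Obj C. iso_class C S\<^sub>1 \<in> \<M> \<longrightarrow> iso_class C S\<^sub>2 \<in> \<M> \<longrightarrow>
      (\<forall>f \<in> Homs C S\<^sub>1 S\<^sub>2. f = zero_arr C S\<^sub>1 S\<^sub>2 \<or> is_mono C f))"

definition cofinally_closed_monobrick ::
    "('o, 'm, 'x) add_cat_scheme \<Rightarrow> 'o set set \<Rightarrow> bool" where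
  "cofinally_closed_monobrick C \<M> \<longleftrightarrow> monobrick C \<M> \<and>
    (\<forall>N M f. is_brick C N \<and> iso_class C N \<notin> \<M> \<and> M \<in> Obj C \<and> iso_class C M \<in> \<M> \<and>
        f \<in> Homs C N M \<and> is_mono C f \<longrightarrow>
      (\<exists>M' \<in> Obj C. iso_class C M' \<in> \<M> \<and>
        (\<exists>g \<in> Homs C N M'. g \<noteq> zero_arr C N M' \<and> \<not> is_mono C g)))"

definition image_classes :: "('o1, 'm1, 'x1) cat_scheme \<Rightarrow> ('o2, 'm2, 'x2) cat_scheme \<Rightarrow>
    ('o1, 'm1, 'o2, 'm2) funct \<Rightarrow> 'o1 set set \<Rightarrow> 'o2 set set" where
  "image_classes C D F \<M> = {iso_class D (on_obj F S) | S. S \<in> Obj C \<and> iso_class C S \<in> \<M>}"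

end

theory Submission
  imports Defs
begin

text \<open>
  If \<open>i\<^sup>!\<close> is exact, there are no nonzero morphisms between the essential images of \<open>i\<^sub>*\<close> and
  \<open>j\<^sub>*\<close> in either direction: from \<open>i\<^sub>*A\<close> to \<open>j\<^sub>*B\<close> because \<open>j\<^sup>*i\<^sub>* = 0\<close>, and from \<open>j\<^sub>*B\<close> to
  \<open>i\<^sub>*A\<close> because such a morphism factors through the cokernel \<open>R\<close> of the counit
  \<open>j\<^sub>!j\<^sup>*j\<^sub>*B \<rightarrow> j\<^sub>*B\<close>; here \<open>j\<^sup>*R = 0\<close>, so that \<open>R\<close> is in the image of \<open>i\<^sub>*\<close>, while \<open>i\<^sup>!R\<close>
  is a quotient of \<open>i\<^sup>!j\<^sub>*B = 0\<close>, whence \<open>R = 0\<close>.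
  Moreover both essential images are closed under subobjects: if \<open>f : N \<rightarrow> j\<^sub>*B\<close> is mono, then the
  unit \<open>N \<rightarrow> j\<^sub>*j\<^sup>*N\<close> is mono since \<open>f\<close> factors through it, and its cokernel, being killed by
  \<open>j\<^sup>*\<close>, vanishes. Since \<open>i\<^sub>*\<close> and \<open>j\<^sub>*\<close> are fully faithful right adjoints, they preserve and
  reflect bricks and monomorphisms, so everything is inherited from \<open>\<Y>\<close> and \<open>\<Z>\<close>.
\<close>

section \<open>Monomorphisms, epimorphisms and isomorphisms in a category\<close>

context category
begin

lemma Homs_Obj: "f \<in> Homs C X Y \<Longrightarrow> X \<in> Obj C" "f \<in> Homs C X Y \<Longrightarrow> Y \<in> Obj C"
  using Dom_in_Obj Cod_in_Obj by (auto simp: Homs_def)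

lemma is_mono_iff:
  assumes "f \<in> Homs C X Y"
  shows "is_mono C f \<longleftrightarrow>
    (\<forall>W. \<forall>g \<in> Homs C W X. \<forall>h \<in> Homs C W X. f \<bullet> g = f \<bullet> h \<longrightarrow> g = h)"
  using assms by (auto simp: is_mono_def Homs_def)

lemma is_epi_iff:
  assumes "f \<in> Homs C X Y"
  shows "is_epi C f \<longleftrightarrow>
    (\<forall>W. \<forall>g \<in> Homs C Y W. \<forall>h \<in> Homs C Y W. g \<bullet> f = h \<bullet> f \<longrightarrow> g = h)"
  using assms by (auto simp: is_epi_def Homs_def)

lemma is_monoD:
  assumes "is_mono C f" "f \<in> Homs C X Y" "g \<in> Homs C W X" "h \<in> Homs C W X" "f \<bullet> g = f \<bullet> h"
  shows "g = h"
  using assms(1)[unfolded is_mono_iff[OF assms(2)]] assms(3-5) by blast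

lemma is_epiD:
  assumes "is_epi C f" "f \<in> Homs C X Y" "g \<in> Homs C Y W" "h \<in> Homs C Y W" "g \<bullet> f = h \<bullet> f"
  shows "g = h"
  using assms(1)[unfolded is_epi_iff[OF assms(2)]] assms(3-5) by blast

lemma is_mono_cancel:
  assumes f: "f \<in> Homs C X Y" and g: "g \<in> Homs C Y Z" and m: "is_mono C (g \<bullet> f)"
  shows "is_mono C f"
  unfolding is_mono_iff[OF f]
proof (intro allI ballI impI)
  fix W a b assume a: "a \<in> Homs C W X" and b: "b \<in> Homs C W X" and eq: "f \<bullet> a = f \<bullet> b"
  have "(g \<bullet> f) \<bullet> a = (g \<bullet> f) \<bullet> b"
    using comp_assoc[OF a f g] comp_assoc[OF b f g] eq by simp
  then show "a = b"
    using m a b is_mono_iff[OF comp_in_Homs[OF f g]] by blast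
qed

lemma is_mono_comp:
  assumes f: "f \<in> Homs C X Y" and g: "g \<in> Homs C Y Z" and m: "is_mono C f" "is_mono C g"
  shows "is_mono C (g \<bullet> f)"
  unfolding is_mono_iff[OF comp_in_Homs[OF f g]]
proof (intro allI ballI impI)
  fix W a b assume a: "a \<in> Homs C W X" and b: "b \<in> Homs C W X"
    and eq: "(g \<bullet> f) \<bullet> a = (g \<bullet> f) \<bullet> b"
  have "g \<bullet> (f \<bullet> a) = g \<bullet> (f \<bullet> b)"
    using comp_assoc[OF a f g] comp_assoc[OF b f g] eq by simp
  then have "f \<bullet> a = f \<bullet> b"
    using m(2) is_mono_iff[OF g] comp_in_Homs[OF a f] comp_in_Homs[OF b f] by blast
  then show "a = b" using m(1) is_mono_iff[OF f] a b by blast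
qed

lemma is_mono_idt: "X \<in> Obj C \<Longrightarrow> is_mono C (idt C X)"
  using is_mono_iff[OF idt_in_Homs] comp_idt_left by metis

lemma is_mono_if_retraction:
  assumes f: "f \<in> Homs C X Y" and g: "g \<in> Homs C Y X" and "g \<bullet> f = idt C X"
  shows "is_mono C f"
  using is_mono_cancel[OF f g] is_mono_idt Homs_Obj(1)[OF f] assms(3) by simp

lemma isomorphicI:
  assumes "f \<in> Homs C X Y" "g \<in> Homs C Y X" "g \<bullet> f = idt C X" "f \<bullet> g = idt C Y"
  shows "isomorphic C X Y"
  using assms by (auto simp: isomorphic_def is_isomorphism_def Homs_def)

lemma isomorphicE:
  assumes "isomorphic C X Y"
  obtains f g where "f \<in> Homs C X Y" "g \<in> Homs C Y X" "g \<bullet> f = idt C X" "f \<bullet> g = idt C Y"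
  using assms by (fastforce simp: isomorphic_def is_isomorphism_def Homs_def)

lemma isomorphic_refl: "X \<in> Obj C \<Longrightarrow> isomorphic C X X"
  by (rule isomorphicI) (auto simp: idt_in_Homs intro: comp_idt_left[OF idt_in_Homs])

lemma isomorphic_sym: "isomorphic C X Y \<Longrightarrow> isomorphic C Y X"
  by (meson isomorphicE isomorphicI)

text \<open>One-sided on purpose: both identities needed for \<open>isomorphic_trans\<close> are
  instances, the second one with the two pairs exchanged and reversed.\<close>

lemma comp_inverses:
  assumes "f \<in> Homs C X Y" "g \<in> Homs C Y X" "g \<bullet> f = idt C X"
    and "f' \<in> Homs C Y Z" "g' \<in> Homs C Z Y" "g' \<bullet> f' = idt C Y"
  shows "(g \<bullet> g') \<bullet> (f' \<bullet> f) = idt C X"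
proof -
  have f'f: "f' \<bullet> f \<in> Homs C X Z" using assms(1,4) by (rule comp_in_Homs)
  have "(g \<bullet> g') \<bullet> (f' \<bullet> f) = g \<bullet> (g' \<bullet> (f' \<bullet> f))"
    by (rule comp_assoc[OF f'f assms(5,2)])
  also have "g' \<bullet> (f' \<bullet> f) = (g' \<bullet> f') \<bullet> f"
    by (rule comp_assoc[symmetric, OF assms(1,4,5)])
  finally show ?thesis using assms by (simp add: comp_idt_left)
qed

lemma isomorphic_trans:
  assumes "isomorphic C X Y" "isomorphic C Y Z"
  shows "isomorphic C X Z"
proof -
  obtain f g where f: "f \<in> Homs C X Y" "g \<in> Homs C Y X" "g \<bullet> f = idt C X" "f \<bullet> g = idt C Y"
    using assms(1) by (rule isomorphicE)
  obtain f' g' where f': "f' \<in> Homs C Y Z" "g' \<in> Homs C Z Y" "g' \<bullet> f' = idt C Y" "f' \<bullet> g' = idt C Z"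
    using assms(2) by (rule isomorphicE)
  show ?thesis
    by (rule isomorphicI[of "f' \<bullet> f" _ _ "g \<bullet> g'"])
      (use f f' comp_in_Homs comp_inverses in blast)+
qed

lemma iso_class_eq_iff:
  assumes "X \<in> Obj C" "Y \<in> Obj C"
  shows "iso_class C X = iso_class C Y \<longleftrightarrow> isomorphic C X Y"
  using assms isomorphic_refl isomorphic_sym isomorphic_trans unfolding iso_class_def by blast

end

section \<open>Zero morphisms and zero objects\<close>

context preadditive_category
begin

lemma zero_in_Homs:
  assumes "X \<in> Obj C" "Y \<in> Obj C"
  shows "zero_arr C X Y \<in> Homs C X Y"
proof -
  interpret G: comm_group "hom_group C X Y"
    using comm_group_hom_group assms by blast
  show ?thesis using G.one_closed by (simp add: hom_group_def)
qed

text \<open>Cancellation in the hom-group. Bilinearity gives 0f = (0 + 0)f = 0f + 0f, so this yields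
  that composites with zero morphisms vanish, which is not an axiom here.\<close>

lemma plus_self_eq_zero:
  assumes f: "f \<in> Homs C X Y" and "plus_arr C f f = f"
  shows "f = zero_arr C X Y"
proof -
  interpret G: comm_group "hom_group C X Y"
    using comm_group_hom_group Homs_Obj[OF f] by blast
  show ?thesis using G.l_cancel_one[of f f] assms by (simp add: hom_group_def)
qed

lemma plus_zero_zero:
  assumes "X \<in> Obj C" "Y \<in> Obj C"
  shows "plus_arr C (zero_arr C X Y) (zero_arr C X Y) = zero_arr C X Y"
proof -
  interpret G: comm_group "hom_group C X Y"
    using comm_group_hom_group assms by blast
  show ?thesis using G.l_one[OF G.one_closed] by (simp add: hom_group_def)
qed

lemma comp_zero_left:
  assumes f: "f \<in> Homs C X Y" and Z: "Z \<in> Obj C"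
  shows "zero_arr C Y Z \<bullet> f = zero_arr C X Z"
proof -
  have z: "zero_arr C Y Z \<in> Homs C Y Z" using zero_in_Homs Homs_Obj[OF f] Z by blast
  show ?thesis
    using plus_self_eq_zero[OF comp_in_Homs[OF f z]] comp_plus_left[OF f z z]
      plus_zero_zero[OF Homs_Obj(2)[OF f] Z] by simp
qed

lemma comp_zero_right:
  assumes f: "f \<in> Homs C Y Z" and X: "X \<in> Obj C"
  shows "f \<bullet> zero_arr C X Y = zero_arr C X Z"
proof -
  have z: "zero_arr C X Y \<in> Homs C X Y" using zero_in_Homs Homs_Obj[OF f] X by blast
  show ?thesis
    using plus_self_eq_zero[OF comp_in_Homs[OF z f]] comp_plus_right[OF z z f]
      plus_zero_zero[OF X Homs_Obj(1)[OF f]] by simp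
qed

lemma Homs_eq_zero_if_idt_zero:
  assumes "X \<in> Obj C" "Y \<in> Obj C" and "idt C X = zero_arr C X X \<or> idt C Y = zero_arr C Y Y"
  shows "Homs C X Y = {zero_arr C X Y}"
proof -
  have "f = zero_arr C X Y" if f: "f \<in> Homs C X Y" for f
    using assms(3) comp_idt_left[OF f] comp_idt_right[OF f]
      comp_zero_left[OF f assms(2)] comp_zero_right[OF f assms(1)] by auto
  then show ?thesis using zero_in_Homs assms by blast
qed

text \<open>If the identity is zero, then every morphism into or out of the object, being a
  composite with it, is zero. This turns a universal property into one equation.\<close>

lemma is_zero_object_iff:
  "is_zero_object C X \<longleftrightarrow> X \<in> Obj C \<and> idt C X = zero_arr C X X"
proof
  assume "is_zero_object C X"
  then show "X \<in> Obj C \<and> idt C X = zero_arr C X X"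
    using idt_in_Homs zero_in_Homs unfolding is_zero_object_def by blast
next
  assume "X \<in> Obj C \<and> idt C X = zero_arr C X X"
  then show "is_zero_object C X"
    unfolding is_zero_object_def by (auto simp: Homs_eq_zero_if_idt_zero)
qed

lemma Homs_zero_object:
  assumes "is_zero_object C X" "Y \<in> Obj C"
  shows "Homs C X Y = {zero_arr C X Y}" "Homs C Y X = {zero_arr C Y X}"
  using assms Homs_eq_zero_if_idt_zero by (auto simp: is_zero_object_iff)

lemma is_zero_objectI: "\<lbrakk>X \<in> Obj C; Homs C X X = {zero_arr C X X}\<rbrakk> \<Longrightarrow> is_zero_object C X"
  using idt_in_Homs is_zero_object_iff by blast

lemma is_zero_object_if_zero_epi:
  assumes f: "f \<in> Homs C X Y" and "is_epi C f" and "f = zero_arr C X Y"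
  shows "is_zero_object C Y"
proof -
  have Y: "Y \<in> Obj C" using Homs_Obj f by blast
  have "idt C Y \<bullet> f = zero_arr C Y Y \<bullet> f"
    using comp_idt_left[OF f] comp_zero_left[OF f Y] assms(3) by simp
  then show ?thesis
    using assms(2) is_epi_iff[OF f] Y idt_in_Homs zero_in_Homs is_zero_object_iff by blast
qed

lemma is_zero_object_if_zero_mono:
  assumes f: "f \<in> Homs C X Y" and "is_mono C f" and "f = zero_arr C X Y"
  shows "is_zero_object C X"
proof -
  have X: "X \<in> Obj C" using Homs_Obj f by blast
  have "f \<bullet> idt C X = f \<bullet> zero_arr C X X"
    using comp_idt_right[OF f] comp_zero_right[OF f X] assms(3) by simp
  then show ?thesis
    using assms(2) is_mono_iff[OF f] X idt_in_Homs zero_in_Homs is_zero_object_iff by blast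
qed

lemma is_zero_object_isomorphic:
  assumes "is_zero_object C X" "isomorphic C X Y"
  shows "is_zero_object C Y"
proof -
  obtain f g where f: "f \<in> Homs C X Y" "g \<in> Homs C Y X" "f \<bullet> g = idt C Y"
    using assms(2) by (rule isomorphicE)
  have Y: "Y \<in> Obj C" using f Homs_Obj by blast
  have "f = zero_arr C X Y" using Homs_zero_object[OF assms(1) Y] f by blast
  then show ?thesis using comp_zero_left[OF f(2) Y] f(3) Y is_zero_object_iff by simp
qed

section \<open>Kernels and cokernels\<close>

lemma is_kernelD:
  assumes "is_kernel C f k" "f \<in> Homs C X Y"
  shows "k \<in> Homs C (Dom C k) X" "f \<bullet> k = zero_arr C (Dom C k) Y"
    "\<And>W g. \<lbrakk>g \<in> Homs C W X; f \<bullet> g = zero_arr C W Y\<rbrakk> \<Longrightarrow> \<exists>u \<in> Homs C W (Dom C k). k \<bullet> u = g"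
proof -
  have eqs: "f \<in> Arr C" "Dom C f = X" "Cod C f = Y" using assms(2) by (auto simp: Homs_def)
  show "k \<in> Homs C (Dom C k) X" "f \<bullet> k = zero_arr C (Dom C k) Y"
    using assms(1) eqs by (simp_all add: is_kernel_def Homs_def)
  fix W g assume "g \<in> Homs C W X" "f \<bullet> g = zero_arr C W Y"
  then have "\<exists>!u. u \<in> Homs C W (Dom C k) \<and> k \<bullet> u = g"
    using assms(1) eqs by (simp add: is_kernel_def)
  then show "\<exists>u \<in> Homs C W (Dom C k). k \<bullet> u = g" by (elim ex1E) blast
qed

lemma is_cokernelD:
  assumes "is_cokernel C f q" "f \<in> Homs C X Y"
  shows "q \<in> Homs C Y (Cod C q)" "q \<bullet> f = zero_arr C X (Cod C q)"
    "\<And>W g. \<lbrakk>g \<in> Homs C Y W; g \<bullet> f = zero_arr C X W\<rbrakk> \<Longrightarrow> \<exists>u \<in> Homs C (Cod C q) W. u \<bullet> q = g"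
proof -
  have eqs: "f \<in> Arr C" "Dom C f = X" "Cod C f = Y" using assms(2) by (auto simp: Homs_def)
  show "q \<in> Homs C Y (Cod C q)" "q \<bullet> f = zero_arr C X (Cod C q)"
    using assms(1) eqs by (simp_all add: is_cokernel_def Homs_def)
  fix W g assume "g \<in> Homs C Y W" "g \<bullet> f = zero_arr C X W"
  then have "\<exists>!u. u \<in> Homs C (Cod C q) W \<and> u \<bullet> q = g"
    using assms(1) eqs by (simp add: is_cokernel_def)
  then show "\<exists>u \<in> Homs C (Cod C q) W. u \<bullet> q = g" by (elim ex1E) blast
qed

text \<open>If g and h agree after \<open>q\<close>, their common composite with \<open>q\<close>
  kills \<open>f\<close> and hence factors through \<open>q\<close> in exactly one way.\<close>

lemma is_epi_cokernel:
  assumes "is_cokernel C f q"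
  shows "is_epi C q"
proof -
  define X Y Q where "X = Dom C f" and "Y = Cod C f" and "Q = Cod C q"
  have f: "f \<in> Homs C X Y" and q: "q \<in> Homs C Y Q"
    using assms by (auto simp: is_cokernel_def Homs_def X_def Y_def Q_def)
  show ?thesis
    unfolding is_epi_iff[OF q]
  proof (intro allI ballI impI)
    fix W g h assume g: "g \<in> Homs C Q W" and h: "h \<in> Homs C Q W" and eq: "g \<bullet> q = h \<bullet> q"
    have "(g \<bullet> q) \<bullet> f = zero_arr C X W"
      using comp_assoc[OF f q g] is_cokernelD(2)[OF assms f]
        comp_zero_right[OF g Homs_Obj(1)[OF f]] by (simp add: Q_def)
    then have "\<exists>!u. u \<in> Homs C Q W \<and> u \<bullet> q = g \<bullet> q"
      using assms comp_in_Homs[OF q g] by (simp add: is_cokernel_def X_def Y_def Q_def)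
    then show "g = h" using g h eq by metis
  qed
qed

text \<open>Since \<open>q\<close> kills \<open>f\<close>, \<open>f\<close> factors through the
  kernel \<open>k\<close>; so whatever kills \<open>k\<close> also kills \<open>f\<close> and
  factors uniquely through \<open>q\<close>. This puts a cokernel into a short exact sequence, the
  form in which exactness of functors is stated.\<close>

lemma is_cokernel_kernel:
  assumes q: "is_cokernel C f q" and k: "is_kernel C q k"
  shows "is_cokernel C k q"
proof -
  define X Y Q K where "X = Dom C f" and "Y = Cod C f" and "Q = Cod C q" and "K = Dom C k"
  have Hf: "f \<in> Homs C X Y" and Hq: "q \<in> Homs C Y Q"
    using q by (auto simp: is_cokernel_def Homs_def X_def Y_def Q_def)
  have Hk: "k \<in> Homs C K Y" and qk: "q \<bullet> k = zero_arr C K Q"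
    using is_kernelD[OF k Hq] by (auto simp: K_def)
  obtain v where v: "v \<in> Homs C X K" "k \<bullet> v = f"
    using is_kernelD(3)[OF k Hq Hf] is_cokernelD(2)[OF q Hf] by (auto simp: K_def Q_def)
  have "\<exists>!u. u \<in> Homs C Q W \<and> u \<bullet> q = g"
    if g: "g \<in> Homs C Y W" and gk: "g \<bullet> k = zero_arr C K W" for W g
  proof -
    have "g \<bullet> f = zero_arr C X W"
      using comp_assoc[OF v(1) Hk g] comp_zero_left[OF v(1) Homs_Obj(2)[OF g]] gk v(2) by simp
    then show ?thesis using q g by (simp add: is_cokernel_def X_def Y_def Q_def)
  qed
  moreover have "k \<in> Arr C" "q \<in> Arr C" "Dom C k = K" "Cod C k = Y" "Dom C q = Y" "Cod C q = Q"
    using Hk Hq by (auto simp: Homs_def)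
  ultimately show ?thesis
    using qk by (simp add: is_cokernel_def)
qed

section \<open>Bricks\<close>

lemma is_brick_iff:
  "is_brick C S \<longleftrightarrow> S \<in> Obj C \<and> idt C S \<noteq> zero_arr C S S \<and>
    (\<forall>f \<in> Homs C S S. f \<noteq> zero_arr C S S \<longrightarrow>
      (\<exists>g \<in> Homs C S S. g \<bullet> f = idt C S \<and> f \<bullet> g = idt C S))"
proof (cases "S \<in> Obj C")
  case S: True
  interpret G: comm_group "hom_group C S S" using comm_group_hom_group S by blast
  have ring: "ring (End_ring C S)"
  proof (rule ringI)
    have "add_monoid (End_ring C S) = hom_group C S S"
      by (simp add: End_ring_def hom_group_def)
    then show "abelian_group (End_ring C S)"
      using G.comm_group_axioms
      by (intro abelian_group.intro abelian_monoid.intro abelian_group_axioms.intro)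
        (auto simp: comm_group_def)
    show "monoid (End_ring C S)"
      by (rule monoidI)
        (simp_all add: End_ring_def S idt_in_Homs comp_in_Homs[of _ S S _ S]
          comp_assoc[of _ S S _ S _ S] comp_idt_left[of _ S S] comp_idt_right[of _ S S])
  qed (simp_all add: End_ring_def comp_plus_left[of _ S S _ S] comp_plus_right[of _ S S _ _ S])
  \<comment> \<open>In a nonzero endomorphism ring zero is not a unit, so the units lie among the
    nonzero elements and only the converse inclusion carries information.\<close>
  have zero: "f \<noteq> zero_arr C S S"
    if "idt C S \<noteq> zero_arr C S S" "g \<in> Homs C S S" "g \<bullet> f = idt C S" for f g
    using that comp_zero_right[OF that(2) S] by metis
  show ?thesis
  proof (cases "idt C S = zero_arr C S S")
    case True
    then show ?thesis by (simp add: is_brick_def is_division_ring_def End_ring_def)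
  next
    case False
    have "Units (End_ring C S) = {f \<in> Homs C S S. \<exists>g \<in> Homs C S S. g \<bullet> f = idt C S \<and> f \<bullet> g = idt C S}"
      by (simp add: Units_def End_ring_def)
    moreover have "carrier (End_ring C S) - {\<zero>\<^bsub>End_ring C S\<^esub>} = {f \<in> Homs C S S. f \<noteq> zero_arr C S S}"
      by (auto simp: End_ring_def)
    moreover have "\<one>\<^bsub>End_ring C S\<^esub> \<noteq> \<zero>\<^bsub>End_ring C S\<^esub>" using False by (simp add: End_ring_def)
    ultimately show ?thesis
      using ring S False zero unfolding is_brick_def is_division_ring_def by blast
  qed
qed (auto simp: is_brick_def)

text \<open>Conjugation with the isomorphism carries a nonzero endomorphism of \<open>T\<close> to
  one of \<open>S\<close>, which has an inverse; conjugating that inverse back inverts the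
  original.\<close>

lemma is_brick_isomorphic:
  assumes brick: "is_brick C S" and iso: "isomorphic C S T"
  shows "is_brick C T"
proof -
  obtain u v where u: "u \<in> Homs C S T" and v: "v \<in> Homs C T S"
    and vu: "v \<bullet> u = idt C S" and uv: "u \<bullet> v = idt C T"
    using iso by (rule isomorphicE)
  have S: "S \<in> Obj C" and T: "T \<in> Obj C" using u Homs_Obj by auto
  have "\<not> is_zero_object C T"
    using brick is_zero_object_isomorphic[OF _ isomorphic_sym[OF iso]]
    by (auto simp: is_brick_iff is_zero_object_iff)
  moreover have "\<exists>g \<in> Homs C T T. g \<bullet> f = idt C T \<and> f \<bullet> g = idt C T"
    if f: "f \<in> Homs C T T" and nz: "f \<noteq> zero_arr C T T" for f
  proof -
    define f' where "f' = v \<bullet> (f \<bullet> u)"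
    have f': "f' \<in> Homs C S S" using u v f by (auto simp: f'_def intro: comp_in_Homs)
    have fu: "f \<bullet> u \<in> Homs C S T" using u f by (rule comp_in_Homs)
    have "u \<bullet> f' = (u \<bullet> v) \<bullet> (f \<bullet> u)"
      unfolding f'_def by (rule comp_assoc[symmetric, OF fu v u])
    then have uf': "u \<bullet> f' = f \<bullet> u" using fu by (simp add: uv comp_idt_left)
    have "(f \<bullet> u) \<bullet> v = f \<bullet> (u \<bullet> v)" by (rule comp_assoc[OF v u f])
    then have fuv: "(f \<bullet> u) \<bullet> v = f" using f by (simp add: uv comp_idt_right)
    have "f' \<noteq> zero_arr C S S"
      using uf' fuv nz comp_zero_right[OF u S] comp_zero_left[OF v T] by auto
    then obtain g where g: "g \<in> Homs C S S" "g \<bullet> f' = idt C S" "f' \<bullet> g = idt C S"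
      using brick f' by (auto simp: is_brick_iff)
    have f_eq: "f = (u \<bullet> f') \<bullet> v" using uf' fuv by simp
    \<comment> \<open>The inverse \<open>g\<close> of the conjugate \<open>f'\<close>, carried back
      to \<open>T\<close>. The facts \<open>cancel\<close> and \<open>mid\<close> remove the inner v
      u from the products of \<open>?g\<close> with f = u f' v.\<close>
    let ?g = "u \<bullet> (g \<bullet> v)"
    have gv: "g \<bullet> v \<in> Homs C T S" using v g by (blast intro: comp_in_Homs)
    have f'v: "f' \<bullet> v \<in> Homs C T S" using v f' by (blast intro: comp_in_Homs)
    have f_eq': "f = u \<bullet> (f' \<bullet> v)" using f_eq comp_assoc[OF v f' u] by simp
    have cancel: "(u \<bullet> a) \<bullet> (u \<bullet> b) = u \<bullet> (a \<bullet> (u \<bullet> b))"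
      if "a \<in> Homs C T S" "b \<in> Homs C T S" for a b
      using that u by (intro comp_assoc[of _ T T]) (auto intro: comp_in_Homs)
    have mid: "(a \<bullet> v) \<bullet> (u \<bullet> (b \<bullet> v)) = (a \<bullet> b) \<bullet> v"
      if a: "a \<in> Homs C S S" and b: "b \<in> Homs C S S" for a b
    proof -
      have bv: "b \<bullet> v \<in> Homs C T S" using b v by (blast intro: comp_in_Homs)
      have "(a \<bullet> v) \<bullet> (u \<bullet> (b \<bullet> v)) = a \<bullet> (v \<bullet> (u \<bullet> (b \<bullet> v)))"
        by (rule comp_assoc[OF comp_in_Homs[OF bv u] v a])
      also have "v \<bullet> (u \<bullet> (b \<bullet> v)) = b \<bullet> v"
        using comp_assoc[OF bv u v] comp_idt_left[OF bv] vu by simp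
      also have "a \<bullet> (b \<bullet> v) = (a \<bullet> b) \<bullet> v"
        by (rule comp_assoc[symmetric, OF v b a])
      finally show ?thesis .
    qed
    have "?g \<bullet> f = idt C T" "f \<bullet> ?g = idt C T"
      using cancel[OF gv f'v] cancel[OF f'v gv] mid[OF g(1) f'] mid[OF f' g(1)]
        f_eq' g(2,3) comp_idt_left[OF v] uv by auto
    then show ?thesis using comp_in_Homs[OF gv u] by blast
  qed
  ultimately show ?thesis using T by (auto simp: is_brick_iff is_zero_object_iff)
qed

end

section \<open>Monomorphisms and short exact sequences in abelian categories\<close>

context abelian_category
begin

text \<open>The monomorphism is the kernel of some g, and g factors through the zero cokernel. Hence
  g = 0, so the identity of \<open>Y\<close> factors through \<open>f\<close>; the resulting section
  is a two-sided inverse because \<open>f\<close> is mono.\<close>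

lemma isomorphic_if_mono_zero_cokernel:
  assumes f: "f \<in> Homs C X Y" and mono: "is_mono C f"
    and q: "is_cokernel C f q" and zero: "q = zero_arr C Y (Cod C q)"
  shows "isomorphic C X Y"
proof -
  obtain g where g: "is_kernel C g f" using mono mono_is_kernel by blast
  define W where "W = Cod C g"
  have Hg: "g \<in> Homs C Y W" and gf: "g \<bullet> f = zero_arr C X W"
    using g f by (auto simp: is_kernel_def Homs_def W_def)
  have W: "W \<in> Obj C" and Y: "Y \<in> Obj C" using Hg Homs_Obj by auto
  obtain u where u: "u \<in> Homs C (Cod C q) W" "u \<bullet> q = g"
    using is_cokernelD(3)[OF q f Hg gf] by blast
  have "g = zero_arr C Y W" using u zero comp_zero_right[OF u(1) Y] by metis
  then have "g \<bullet> idt C Y = zero_arr C Y W" using comp_idt_right[OF Hg] by simp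
  then obtain s where s: "s \<in> Homs C Y X" "f \<bullet> s = idt C Y"
    using is_kernelD(3)[OF g Hg idt_in_Homs[OF Y]] f by (auto simp: Homs_def)
  have "f \<bullet> (s \<bullet> f) = f \<bullet> idt C X"
    using comp_assoc[OF f s(1) f] s(2) comp_idt_left[OF f] comp_idt_right[OF f] by simp
  then have "s \<bullet> f = idt C X"
    using mono is_mono_iff[OF f] comp_in_Homs[OF f s(1)] idt_in_Homs Homs_Obj(1)[OF f] by blast
  then show ?thesis using f s isomorphicI by blast
qed

lemma short_exact_kernel_cokernel:
  assumes q: "is_cokernel C f q"
  obtains k where "short_exact C k q"
proof -
  have "q \<in> Arr C" using q by (simp add: is_cokernel_def)
  then obtain k where "is_kernel C q k" using ex_kernel by blast
  then show ?thesis using that is_cokernel_kernel[OF q] by (auto simp: short_exact_def)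
qed

end

section \<open>Functors, zero morphisms and exactness\<close>

lemma is_functorD:
  assumes "is_functor C D F"
  shows "X \<in> Obj C \<Longrightarrow> on_obj F X \<in> Obj D"
    "f \<in> Homs C X Y \<Longrightarrow> on_arr F f \<in> Homs D (on_obj F X) (on_obj F Y)"
    "X \<in> Obj C \<Longrightarrow> on_arr F (idt C X) = idt D (on_obj F X)"
    "\<lbrakk>f \<in> Homs C X Y; g \<in> Homs C Y Z\<rbrakk>
      \<Longrightarrow> on_arr F (g \<bullet>\<^bsub>C\<^esub> f) = on_arr F g \<bullet>\<^bsub>D\<^esub> on_arr F f"
  using assms unfolding is_functor_def by blast+

lemma functor_zero_arr:
  assumes C: "abelian_category C" and D: "preadditive_category D" and F: "is_functor C D F"
    and zero: "\<And>Z. is_zero_object C Z \<Longrightarrow> is_zero_object D (on_obj F Z)"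
    and X: "X \<in> Obj C" and Y: "Y \<in> Obj C"
  shows "on_arr F (zero_arr C X Y) = zero_arr D (on_obj F X) (on_obj F Y)"
proof -
  interpret C: abelian_category C by (rule C)
  interpret D: preadditive_category D by (rule D)
  obtain Z where Z: "is_zero_object C Z" using C.ex_zero_object by blast
  then have ZO: "Z \<in> Obj C" by (simp add: is_zero_object_def)
  have a: "zero_arr C X Z \<in> Homs C X Z" and b: "zero_arr C Z Y \<in> Homs C Z Y"
    using C.zero_in_Homs X Y ZO by auto
  have "on_arr F (zero_arr C X Z) = zero_arr D (on_obj F X) (on_obj F Z)"
    using is_functorD(2)[OF F a] D.Homs_zero_object(2)[OF zero[OF Z] is_functorD(1)[OF F X]]
    by blast
  moreover have "zero_arr C X Y = zero_arr C Z Y \<bullet>\<^bsub>C\<^esub> zero_arr C X Z"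
    using C.comp_zero_left[OF a Y] by simp
  ultimately show ?thesis
    using is_functorD(4)[OF F a b] D.comp_zero_right[OF is_functorD(2)[OF F b] is_functorD(1)[OF F X]]
    by simp
qed

text \<open>Exactness speaks of short exact sequences only, so \<open>q\<close> is first completed
  by its kernel; its image is then a cokernel, hence epi.\<close>

lemma exact_functor_epi:
  assumes C: "abelian_category C" and D: "preadditive_category D" and F: "exact_functor C D F"
    and q: "is_cokernel C f q"
  shows "is_epi D (on_arr F q)"
proof -
  obtain k where "short_exact C k q"
    using abelian_category.short_exact_kernel_cokernel[OF C q] .
  then have "short_exact D (on_arr F k) (on_arr F q)"
    using F by (simp add: exact_functor_def)
  then show ?thesis
    using preadditive_category.is_epi_cokernel[OF D] by (auto simp: short_exact_def)
qed

section \<open>Adjunctions between abelian categories\<close>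

locale adjunction = C: abelian_category C + D: abelian_category D
  for C :: "('o1, 'm1, 'x1) add_cat_scheme"
    and D :: "('o2, 'm2, 'x2) add_cat_scheme" +
  fixes F :: "('o1, 'm1, 'o2, 'm2) funct" and G :: "('o2, 'm2, 'o1, 'm1) funct"
  assumes adjoint: "adjoint_pair C D F G"
begin

lemma functor_F: "is_functor C D F" and functor_G: "is_functor D C G"
  using adjoint by (auto simp: adjoint_pair_def)

lemmas F_Obj = is_functorD(1)[OF functor_F] and F_Homs = is_functorD(2)[OF functor_F]
  and F_idt = is_functorD(3)[OF functor_F] and F_comp = is_functorD(4)[OF functor_F]
  and G_Obj = is_functorD(1)[OF functor_G] and G_Homs = is_functorD(2)[OF functor_G]
  and G_idt = is_functorD(3)[OF functor_G] and G_comp = is_functorD(4)[OF functor_G]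

text \<open>The property under the existential quantifier of \<open>adjoint_pair\<close>, named so
  that one natural bijection can be fixed by choice in \<open>transp\<close>.\<close>

definition is_transposition :: "('o1 \<Rightarrow> 'o2 \<Rightarrow> 'm2 \<Rightarrow> 'm1) \<Rightarrow> bool" where
  "is_transposition \<phi> \<longleftrightarrow>
    (\<forall>X \<in> Obj C. \<forall>Y \<in> Obj D.
      bij_betw (\<phi> X Y) (Homs D (on_obj F X) Y) (Homs C X (on_obj G Y))) \<and>
    (\<forall>X' X Y Y'. \<forall>f \<in> Homs C X' X. \<forall>g \<in> Homs D (on_obj F X) Y. \<forall>h \<in> Homs D Y Y'.
      \<phi> X' Y' (h \<bullet>\<^bsub>D\<^esub> (g \<bullet>\<^bsub>D\<^esub> on_arr F f)) = on_arr G h \<bullet>\<^bsub>C\<^esub> (\<phi> X Y g \<bullet>\<^bsub>C\<^esub> f))"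

definition transp :: "'o1 \<Rightarrow> 'o2 \<Rightarrow> 'm2 \<Rightarrow> 'm1" where
  "transp = (SOME \<phi>. is_transposition \<phi>)"

lemma is_transposition_transp: "is_transposition transp"
proof -
  have "\<exists>\<phi>. is_transposition \<phi>"
    unfolding is_transposition_def
    by (rule adjoint[unfolded adjoint_pair_def, THEN conjunct2, THEN conjunct2])
  then show ?thesis unfolding transp_def by (rule someI_ex)
qed

lemma transp_bij:
  assumes "X \<in> Obj C" "Y \<in> Obj D"
  shows "bij_betw (transp X Y) (Homs D (on_obj F X) Y) (Homs C X (on_obj G Y))"
  using is_transposition_transp assms unfolding is_transposition_def by simp

lemma transp_natural:
  assumes "f \<in> Homs C X' X" "g \<in> Homs D (on_obj F X) Y" "h \<in> Homs D Y Y'"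
  shows "transp X' Y' (h \<bullet>\<^bsub>D\<^esub> (g \<bullet>\<^bsub>D\<^esub> on_arr F f)) = on_arr G h \<bullet>\<^bsub>C\<^esub> (transp X Y g \<bullet>\<^bsub>C\<^esub> f)"
  using is_transposition_transp assms unfolding is_transposition_def by simp

lemma transp_Homs:
  assumes "X \<in> Obj C" "g \<in> Homs D (on_obj F X) Y"
  shows "transp X Y g \<in> Homs C X (on_obj G Y)"
  using bij_betwE[OF transp_bij[OF assms(1) D.Homs_Obj(2)[OF assms(2)]]] assms(2) by blast

lemma transp_eqD:
  assumes "transp X Y g = transp X Y h" "X \<in> Obj C"
    and "g \<in> Homs D (on_obj F X) Y" "h \<in> Homs D (on_obj F X) Y"
  shows "g = h"
  by (rule inj_onD[OF bij_betw_imp_inj_on[OF transp_bij[OF assms(2) D.Homs_Obj(2)[OF assms(3)]]]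
        assms(1,3,4)])

lemma ex_transp:
  assumes "f \<in> Homs C X (on_obj G Y)" "Y \<in> Obj D"
  obtains g where "g \<in> Homs D (on_obj F X) Y" "transp X Y g = f"
proof -
  have "f \<in> transp X Y ` Homs D (on_obj F X) Y"
    using bij_betw_imp_surj_on[OF transp_bij[OF C.Homs_Obj(1)[OF assms(1)] assms(2)]] assms(1)
    by simp
  then show ?thesis using that by blast
qed

lemma transp_comp_left:
  assumes X: "X \<in> Obj C" and g: "g \<in> Homs D (on_obj F X) Y" and h: "h \<in> Homs D Y Y'"
  shows "transp X Y' (h \<bullet>\<^bsub>D\<^esub> g) = on_arr G h \<bullet>\<^bsub>C\<^esub> transp X Y g"
proof -
  have "transp X Y' (h \<bullet>\<^bsub>D\<^esub> (g \<bullet>\<^bsub>D\<^esub> on_arr F (idt C X)))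
      = on_arr G h \<bullet>\<^bsub>C\<^esub> (transp X Y g \<bullet>\<^bsub>C\<^esub> idt C X)"
    by (rule transp_natural[OF C.idt_in_Homs[OF X] g h])
  then show ?thesis
    using F_idt[OF X] D.comp_idt_right[OF g] C.comp_idt_right[OF transp_Homs[OF X g]] by simp
qed

lemma transp_comp_right:
  assumes f: "f \<in> Homs C X' X" and g: "g \<in> Homs D (on_obj F X) Y"
  shows "transp X' Y (g \<bullet>\<^bsub>D\<^esub> on_arr F f) = transp X Y g \<bullet>\<^bsub>C\<^esub> f"
proof -
  have X: "X \<in> Obj C" using f C.Homs_Obj by blast
  have Y: "Y \<in> Obj D" using g D.Homs_Obj by blast
  have "transp X' Y (idt D Y \<bullet>\<^bsub>D\<^esub> (g \<bullet>\<^bsub>D\<^esub> on_arr F f))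
      = on_arr G (idt D Y) \<bullet>\<^bsub>C\<^esub> (transp X Y g \<bullet>\<^bsub>C\<^esub> f)"
    by (rule transp_natural[OF f g D.idt_in_Homs[OF Y]])
  then show ?thesis
    using G_idt[OF Y] D.comp_idt_left[OF D.comp_in_Homs[OF F_Homs[OF f] g]]
      C.comp_idt_left[OF C.comp_in_Homs[OF f transp_Homs[OF X g]]] by simp
qed

text \<open>Transposition is not known to be additive at this point. It is a bijection between sets
  that contain a zero morphism, so one is a singleton exactly when the other is.\<close>

lemma Homs_zero_iff:
  assumes X: "X \<in> Obj C" and Y: "Y \<in> Obj D"
  shows "Homs D (on_obj F X) Y = {zero_arr D (on_obj F X) Y}
    \<longleftrightarrow> Homs C X (on_obj G Y) = {zero_arr C X (on_obj G Y)}"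
proof -
  have bij: "bij_betw (transp X Y) (Homs D (on_obj F X) Y) (Homs C X (on_obj G Y))"
    by (rule transp_bij[OF X Y])
  have 1: "zero_arr D (on_obj F X) Y \<in> Homs D (on_obj F X) Y"
    and 2: "zero_arr C X (on_obj G Y) \<in> Homs C X (on_obj G Y)"
    using C.zero_in_Homs D.zero_in_Homs F_Obj G_Obj X Y by auto
  have "A = {a} \<longleftrightarrow> B = {b}" if \<phi>: "bij_betw \<phi> A B" and a: "a \<in> A" and b: "b \<in> B"
    for \<phi> :: "'m2 \<Rightarrow> 'm1" and A B a b
  proof
    assume "A = {a}"
    then have "B = {\<phi> a}" using bij_betw_imp_surj_on[OF \<phi>] by auto
    then show "B = {b}" using b by simp
  next
    assume "B = {b}"
    then have "x = a" if "x \<in> A" for x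
      using bij_betwE[OF \<phi>] bij_betw_imp_inj_on[OF \<phi>, THEN inj_onD, OF _ that a] that a by auto
    then show "A = {a}" using a by blast
  qed
  from this[OF bij 1 2] show ?thesis .
qed

text \<open>Transposition matches End(F X) with Hom(X, G F X), which is trivial when X is zero.
  \<open>G_zero_object\<close> is dual.\<close>

lemma F_zero_object:
  assumes "is_zero_object C X"
  shows "is_zero_object D (on_obj F X)"
proof -
  have X: "X \<in> Obj C" using assms by (simp add: is_zero_object_def)
  show ?thesis
    using D.is_zero_objectI[OF F_Obj[OF X]] Homs_zero_iff[OF X F_Obj[OF X]]
      C.Homs_zero_object(1)[OF assms G_Obj[OF F_Obj[OF X]]] by blast
qed

lemma G_zero_object:
  assumes "is_zero_object D Y"
  shows "is_zero_object C (on_obj G Y)"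
proof -
  have Y: "Y \<in> Obj D" using assms by (simp add: is_zero_object_def)
  show ?thesis
    using C.is_zero_objectI[OF G_Obj[OF Y]] Homs_zero_iff[OF G_Obj[OF Y] Y]
      D.Homs_zero_object(2)[OF assms F_Obj[OF G_Obj[OF Y]]] by blast
qed

lemmas F_zero_arr = functor_zero_arr[OF C.abelian_category_axioms D.preadditive_category_axioms
    functor_F F_zero_object]
  and G_zero_arr = functor_zero_arr[OF D.abelian_category_axioms C.preadditive_category_axioms
    functor_G G_zero_object]

text \<open>Right adjoints preserve monomorphisms: by naturality the test pair can be transposed to
  morphisms out of F W, where \<open>m\<close> cancels. \<open>F_epi\<close> is dual.\<close>

lemma G_mono:
  assumes m: "m \<in> Homs D Y Y'" and "is_mono D m"
  shows "is_mono C (on_arr G m)"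
  unfolding C.is_mono_iff[OF G_Homs[OF m]]
proof (intro allI ballI impI)
  fix W g h assume g: "g \<in> Homs C W (on_obj G Y)" and h: "h \<in> Homs C W (on_obj G Y)"
    and eq: "on_arr G m \<bullet>\<^bsub>C\<^esub> g = on_arr G m \<bullet>\<^bsub>C\<^esub> h"
  have Y: "Y \<in> Obj D" and W: "W \<in> Obj C" using m D.Homs_Obj g C.Homs_Obj by blast+
  obtain g' where g': "g' \<in> Homs D (on_obj F W) Y" "transp W Y g' = g" using g Y by (rule ex_transp)
  obtain h' where h': "h' \<in> Homs D (on_obj F W) Y" "transp W Y h' = h" using h Y by (rule ex_transp)
  have "m \<bullet>\<^bsub>D\<^esub> g' = m \<bullet>\<^bsub>D\<^esub> h'"
    by (rule transp_eqD[of W Y', OF _ W])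
      (use eq transp_comp_left[OF W g'(1) m] transp_comp_left[OF W h'(1) m] g' h'
        D.comp_in_Homs[OF _ m] in simp_all)
  then have "g' = h'" by (rule D.is_monoD[OF assms(2) m g'(1) h'(1)])
  then show "g = h" using g' h' by simp
qed

lemma F_epi:
  assumes e: "e \<in> Homs C X X'" and "is_epi C e"
  shows "is_epi D (on_arr F e)"
  unfolding D.is_epi_iff[OF F_Homs[OF e]]
proof (intro allI ballI impI)
  fix W g h assume g: "g \<in> Homs D (on_obj F X') W" and h: "h \<in> Homs D (on_obj F X') W"
    and eq: "g \<bullet>\<^bsub>D\<^esub> on_arr F e = h \<bullet>\<^bsub>D\<^esub> on_arr F e"
  have X': "X' \<in> Obj C" using e C.Homs_Obj by blast
  have "transp X' W g \<bullet>\<^bsub>C\<^esub> e = transp X' W h \<bullet>\<^bsub>C\<^esub> e"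
    using transp_comp_right[OF e g] transp_comp_right[OF e h] eq by simp
  then have "transp X' W g = transp X' W h"
    by (rule C.is_epiD[OF assms(2) e transp_Homs[OF X' g] transp_Homs[OF X' h]])
  then show "g = h" using X' g h by (rule transp_eqD)
qed

end

section \<open>Adjunctions with fully faithful right adjoint\<close>

locale ff_adjunction = adjunction +
  assumes ff: "fully_faithful D C G"
begin

lemma G_bij:
  "\<lbrakk>X \<in> Obj D; Y \<in> Obj D\<rbrakk>
    \<Longrightarrow> bij_betw (on_arr G) (Homs D X Y) (Homs C (on_obj G X) (on_obj G Y))"
  using ff by (simp add: fully_faithful_def)

lemma G_eqD:
  assumes "on_arr G f = on_arr G g" "f \<in> Homs D X Y" "g \<in> Homs D X Y"
  shows "f = g"
  by (rule inj_onD[OF bij_betw_imp_inj_on[OF G_bij[OF D.Homs_Obj[OF assms(2)]]] assms])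

lemma ex_G:
  assumes "f \<in> Homs C (on_obj G X) (on_obj G Y)" "X \<in> Obj D" "Y \<in> Obj D"
  obtains g where "g \<in> Homs D X Y" "on_arr G g = f"
proof -
  have "f \<in> on_arr G ` Homs D X Y"
    using bij_betw_imp_surj_on[OF G_bij[OF assms(2,3)]] assms(1) by simp
  then show ?thesis using that by blast
qed

lemma G_zero_arr_iff:
  assumes f: "f \<in> Homs D X Y"
  shows "on_arr G f = zero_arr C (on_obj G X) (on_obj G Y) \<longleftrightarrow> f = zero_arr D X Y"
proof -
  have XY: "X \<in> Obj D" "Y \<in> Obj D" using f D.Homs_Obj by auto
  show ?thesis
    using G_zero_arr[OF _ XY] G_eqD[OF _ f D.zero_in_Homs[OF XY]] by auto
qed

text \<open>Faithfulness reflects monomorphisms; preservation comes from the adjunction.\<close>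

lemma G_mono_iff:
  assumes f: "f \<in> Homs D X Y"
  shows "is_mono C (on_arr G f) \<longleftrightarrow> is_mono D f"
proof
  assume mono: "is_mono C (on_arr G f)"
  show "is_mono D f"
    unfolding D.is_mono_iff[OF f]
  proof (intro allI ballI impI)
    fix W g h assume g: "g \<in> Homs D W X" and h: "h \<in> Homs D W X" and "f \<bullet>\<^bsub>D\<^esub> g = f \<bullet>\<^bsub>D\<^esub> h"
    then have "on_arr G f \<bullet>\<^bsub>C\<^esub> on_arr G g = on_arr G f \<bullet>\<^bsub>C\<^esub> on_arr G h"
      using G_comp[OF g f] G_comp[OF h f] by simp
    then have "on_arr G g = on_arr G h"
      by (rule C.is_monoD[OF mono G_Homs[OF f] G_Homs[OF g] G_Homs[OF h]])
    then show "g = h" using g h by (rule G_eqD)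
  qed
qed (rule G_mono[OF f])

lemma G_comp_eq_idt_iff:
  assumes "f \<in> Homs D X Y" "g \<in> Homs D Y X"
  shows "on_arr G g \<bullet>\<^bsub>C\<^esub> on_arr G f = idt C (on_obj G X) \<longleftrightarrow> g \<bullet>\<^bsub>D\<^esub> f = idt D X"
proof -
  have X: "X \<in> Obj D" using assms D.Homs_Obj by blast
  show ?thesis
    using G_comp[OF assms] G_idt[OF X] G_eqD[OF _ D.comp_in_Homs[OF assms] D.idt_in_Homs[OF X]]
    by auto
qed

text \<open>The criterion \<open>is_brick_iff\<close> involves only composition, identities and
  zero, and \<open>G\<close> matches these bijectively on the two endomorphism sets.\<close>

lemma G_brick_iff:
  assumes S: "S \<in> Obj D"
  shows "is_brick C (on_obj G S) \<longleftrightarrow> is_brick D S"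
proof -
  have im: "Homs C (on_obj G S) (on_obj G S) = on_arr G ` Homs D S S"
    using ex_G[OF _ S S] G_Homs by blast
  have "idt C (on_obj G S) = zero_arr C (on_obj G S) (on_obj G S) \<longleftrightarrow> idt D S = zero_arr D S S"
    using G_zero_arr_iff[OF D.idt_in_Homs[OF S]] G_idt[OF S] by simp
  then show ?thesis
    unfolding C.is_brick_iff D.is_brick_iff im
    using S G_Obj[OF S] by (simp add: G_zero_arr_iff G_comp_eq_idt_iff)
qed

text \<open>For fully faithful \<open>G\<close> the counit is invertible, and by a triangle identity
  F \<eta> is then its inverse. It is used to see that the cokernel of the unit \<eta> is killed by
  \<open>F\<close>.\<close>

lemma counit_inverse:
  assumes N: "N \<in> Obj C" and \<eta>: "\<eta> = transp N (on_obj F N) (idt D (on_obj F N))"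
  obtains \<epsilon> where "\<epsilon> \<in> Homs D (on_obj F (on_obj G (on_obj F N))) (on_obj F N)"
    "on_arr F \<eta> \<bullet>\<^bsub>D\<^esub> \<epsilon> = idt D (on_obj F (on_obj G (on_obj F N)))"
proof -
  let ?Z = "on_obj F N"
  let ?GZ = "on_obj G ?Z"
  have Z: "?Z \<in> Obj D" and GZ: "?GZ \<in> Obj C" and FGZ: "on_obj F ?GZ \<in> Obj D"
    using N F_Obj G_Obj by auto
  have Z1: "idt D ?Z \<in> Homs D ?Z ?Z" using D.idt_in_Homs Z by blast
  have H\<eta>: "\<eta> \<in> Homs C N ?GZ" unfolding \<eta> by (rule transp_Homs[OF N Z1])
  \<comment> \<open>The counit at F N, as the morphism whose transpose is the identity.\<close>
  obtain \<epsilon> where \<epsilon>: "\<epsilon> \<in> Homs D (on_obj F ?GZ) ?Z" "transp ?GZ ?Z \<epsilon> = idt C ?GZ"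
    using C.idt_in_Homs[OF GZ] Z by (rule ex_transp)
  have F\<eta>: "on_arr F \<eta> \<in> Homs D ?Z (on_obj F ?GZ)" using H\<eta> by (rule F_Homs)
  have triangle: "\<epsilon> \<bullet>\<^bsub>D\<^esub> on_arr F \<eta> = idt D ?Z"
    by (rule transp_eqD[OF _ N D.comp_in_Homs[OF F\<eta> \<epsilon>(1)] Z1])
      (use transp_comp_right[OF H\<eta> \<epsilon>(1)] \<epsilon>(2) C.comp_idt_left[OF H\<eta>] \<eta> in simp)
  \<comment> \<open>The unit at G F N. Fullness of \<open>G\<close> writes it as G s, and comparing
    transposes shows that s is a left inverse of \<epsilon>; together with \<open>triangle\<close>
    this forces F \<eta> = s.\<close>
  define t where "t = transp ?GZ (on_obj F ?GZ) (idt D (on_obj F ?GZ))"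
  have Ht: "t \<in> Homs C ?GZ (on_obj G (on_obj F ?GZ))"
    unfolding t_def by (rule transp_Homs[OF GZ D.idt_in_Homs[OF FGZ]])
  obtain s where s: "s \<in> Homs D ?Z (on_obj F ?GZ)" "on_arr G s = t"
    using Ht Z FGZ by (rule ex_G)
  have s\<epsilon>: "s \<bullet>\<^bsub>D\<^esub> \<epsilon> = idt D (on_obj F ?GZ)"
    by (rule transp_eqD[OF _ GZ D.comp_in_Homs[OF \<epsilon>(1) s(1)] D.idt_in_Homs[OF FGZ]])
      (use transp_comp_left[OF GZ \<epsilon>(1) s(1)] \<epsilon>(2) s(2) C.comp_idt_right[OF Ht] t_def in simp)
  have "on_arr F \<eta> = (s \<bullet>\<^bsub>D\<^esub> \<epsilon>) \<bullet>\<^bsub>D\<^esub> on_arr F \<eta>"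
    using s\<epsilon> D.comp_idt_left[OF F\<eta>] by simp
  also have "\<dots> = s"
    using D.comp_assoc[OF F\<eta> \<epsilon>(1) s(1)] triangle D.comp_idt_right[OF s(1)] by simp
  finally show ?thesis using that \<epsilon>(1) s\<epsilon> by simp
qed

section \<open>Monobricks in the image of a fully faithful right adjoint\<close>

lemma iso_class_in_image:
  assumes "N \<in> Obj C"
  shows "iso_class C N \<in> image_classes D C G \<M>
    \<longleftrightarrow> (\<exists>S \<in> Obj D. iso_class D S \<in> \<M> \<and> isomorphic C N (on_obj G S))"
  using assms C.iso_class_eq_iff G_Obj unfolding image_classes_def by blast

lemma image_classes_subset_bricks:
  assumes "monobrick D \<M>"
  shows "image_classes D C G \<M> \<subseteq> {iso_class C S | S. is_brick C S}"
proof -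
  \<comment> \<open>Membership in a monobrick only says that the class of \<open>S\<close> is the
    class of some brick, so the property has to be moved to the representative
    \<open>S\<close>.\<close>
  have "is_brick D S" if S: "S \<in> Obj D" "iso_class D S \<in> \<M>" for S
  proof -
    obtain T where T: "iso_class D S = iso_class D T" "is_brick D T"
      using assms S by (auto simp: monobrick_def)
    then have "isomorphic D T S"
      using D.iso_class_eq_iff S D.isomorphic_sym by (auto simp: is_brick_def)
    then show ?thesis using D.is_brick_isomorphic T by blast
  qed
  then show ?thesis using G_brick_iff unfolding image_classes_def by blast
qed

text \<open>Isomorphisms of the two objects with objects in the image of \<open>G\<close> turn
  \<open>f\<close> into G g by fullness. The alternative holds for g in \<open>D\<close> and is
  carried back.\<close>

lemma zero_or_mono_image:
  assumes \<M>: "monobrick D \<M>" and f: "f \<in> Homs C N N'"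
    and N: "iso_class C N \<in> image_classes D C G \<M>"
    and N': "iso_class C N' \<in> image_classes D C G \<M>"
  shows "f = zero_arr C N N' \<or> is_mono C f"
proof -
  have O: "N \<in> Obj C" "N' \<in> Obj C" using f C.Homs_Obj by auto
  obtain S where S: "S \<in> Obj D" "iso_class D S \<in> \<M>" "isomorphic C N (on_obj G S)"
    using N iso_class_in_image O by blast
  obtain S' where S': "S' \<in> Obj D" "iso_class D S' \<in> \<M>" "isomorphic C N' (on_obj G S')"
    using N' iso_class_in_image O by blast
  obtain u v where u: "u \<in> Homs C N (on_obj G S)" and v: "v \<in> Homs C (on_obj G S) N"
    and vu: "v \<bullet>\<^bsub>C\<^esub> u = idt C N" and uv: "u \<bullet>\<^bsub>C\<^esub> v = idt C (on_obj G S)"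
    using S(3) by (rule C.isomorphicE)
  obtain u' v' where u': "u' \<in> Homs C N' (on_obj G S')" and v': "v' \<in> Homs C (on_obj G S') N'"
    and vu': "v' \<bullet>\<^bsub>C\<^esub> u' = idt C N'" and uv': "u' \<bullet>\<^bsub>C\<^esub> v' = idt C (on_obj G S')"
    using S'(3) by (rule C.isomorphicE)
  have fv: "f \<bullet>\<^bsub>C\<^esub> v \<in> Homs C (on_obj G S) N'" using v f by (rule C.comp_in_Homs)
  have "u' \<bullet>\<^bsub>C\<^esub> (f \<bullet>\<^bsub>C\<^esub> v) \<in> Homs C (on_obj G S) (on_obj G S')" using fv u' by (rule C.comp_in_Homs)
  then obtain g where g: "g \<in> Homs D S S'" "on_arr G g = u' \<bullet>\<^bsub>C\<^esub> (f \<bullet>\<^bsub>C\<^esub> v)"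
    using S(1) S'(1) by (rule ex_G)
  have "(f \<bullet>\<^bsub>C\<^esub> v) \<bullet>\<^bsub>C\<^esub> u = f"
    using C.comp_assoc[OF u v f] vu C.comp_idt_right[OF f] by simp
  moreover have "v' \<bullet>\<^bsub>C\<^esub> on_arr G g = f \<bullet>\<^bsub>C\<^esub> v"
    using C.comp_assoc[OF fv u' v'] vu' C.comp_idt_left[OF fv] g(2) by simp
  ultimately have f_eq: "f = (v' \<bullet>\<^bsub>C\<^esub> on_arr G g) \<bullet>\<^bsub>C\<^esub> u" by simp
  have "g = zero_arr D S S' \<or> is_mono D g"
    using \<M> S S' g by (auto simp: monobrick_def)
  then show ?thesis
  proof
    assume "g = zero_arr D S S'"
    then have "on_arr G g = zero_arr C (on_obj G S) (on_obj G S')"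
      using G_zero_arr_iff[OF g(1)] by simp
    then show ?thesis
      using f_eq C.comp_zero_right[OF v' G_Obj[OF S(1)]] C.comp_zero_left[OF u O(2)] by simp
  next
    assume "is_mono D g"
    then have "is_mono C (on_arr G g)" using G_mono[OF g(1)] by blast
    moreover have "is_mono C u" "is_mono C v'"
      using C.is_mono_if_retraction u v u' v' vu uv' by auto
    ultimately have "is_mono C ((v' \<bullet>\<^bsub>C\<^esub> on_arr G g) \<bullet>\<^bsub>C\<^esub> u)"
      using C.is_mono_comp C.comp_in_Homs u v' G_Homs[OF g(1)] by metis
    then show ?thesis using f_eq by simp
  qed
qed

text \<open>The assumption on \<open>B\<close> places \<open>N\<close> itself in the essential
  image, so the whole situation descends to \<open>D\<close>: \<open>f\<close> becomes a
  monomorphism from the brick \<open>B\<close>, and the morphism supplied by closedness in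
  \<open>D\<close> is carried back along the isomorphism from \<open>N\<close> to G B.\<close>

lemma cofinally_closed_image:
  assumes \<M>: "cofinally_closed_monobrick D \<M>"
    and N: "is_brick C N" "iso_class C N \<notin> image_classes D C G \<M>"
    and f: "f \<in> Homs C N M" "is_mono C f" and M: "iso_class C M \<in> image_classes D C G \<M>"
    and B: "B \<in> Obj D" "isomorphic C N (on_obj G B)"
  shows "\<exists>M' \<in> Obj C. iso_class C M' \<in> image_classes D C G \<M> \<and>
    (\<exists>g \<in> Homs C N M'. g \<noteq> zero_arr C N M' \<and> \<not> is_mono C g)"
proof -
  have O: "N \<in> Obj C" "M \<in> Obj C" using f C.Homs_Obj by auto
  obtain S where S: "S \<in> Obj D" "iso_class D S \<in> \<M>" "isomorphic C M (on_obj G S)"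
    using M iso_class_in_image O by blast
  obtain u v where u: "u \<in> Homs C N (on_obj G B)" and v: "v \<in> Homs C (on_obj G B) N"
    and vu: "v \<bullet>\<^bsub>C\<^esub> u = idt C N" and uv: "u \<bullet>\<^bsub>C\<^esub> v = idt C (on_obj G B)"
    using B(2) by (rule C.isomorphicE)
  obtain u' v' where u': "u' \<in> Homs C M (on_obj G S)" and v': "v' \<in> Homs C (on_obj G S) M"
    and vu': "v' \<bullet>\<^bsub>C\<^esub> u' = idt C M"
    using S(3) by (rule C.isomorphicE)
  have fv: "f \<bullet>\<^bsub>C\<^esub> v \<in> Homs C (on_obj G B) M" using v f(1) by (rule C.comp_in_Homs)
  have "u' \<bullet>\<^bsub>C\<^esub> (f \<bullet>\<^bsub>C\<^esub> v) \<in> Homs C (on_obj G B) (on_obj G S)" using fv u' by (rule C.comp_in_Homs)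
  then obtain h where h: "h \<in> Homs D B S" "on_arr G h = u' \<bullet>\<^bsub>C\<^esub> (f \<bullet>\<^bsub>C\<^esub> v)"
    using B(1) S(1) by (rule ex_G)
  have "is_mono C u'" "is_mono C v"
    using C.is_mono_if_retraction u v u' v' vu' uv by auto
  then have "is_mono C (on_arr G h)"
    using C.is_mono_comp[OF v f(1)] C.is_mono_comp[OF fv u'] f(2) h(2) by simp
  then have h_mono: "is_mono D h" using G_mono_iff[OF h(1)] by simp
  have "is_brick D B" using C.is_brick_isomorphic[OF N(1) B(2)] G_brick_iff[OF B(1)] by simp
  moreover have "iso_class D B \<notin> \<M>" using N(2) B iso_class_in_image[OF O(1)] by blast
  ultimately obtain S' g where S': "S' \<in> Obj D" "iso_class D S' \<in> \<M>"
    and g: "g \<in> Homs D B S'" "g \<noteq> zero_arr D B S'" "\<not> is_mono D g"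
    using \<M> S h(1) h_mono unfolding cofinally_closed_monobrick_def by blast
  have Gg: "on_arr G g \<in> Homs C (on_obj G B) (on_obj G S')" using g(1) by (rule G_Homs)
  have GS': "on_obj G S' \<in> Obj C" using S'(1) by (rule G_Obj)
  \<comment> \<open>Composing with the isomorphism \<open>v\<close> recovers G g, so if the
    transported morphism were zero or mono, then g would be too.\<close>
  have guv: "(on_arr G g \<bullet>\<^bsub>C\<^esub> u) \<bullet>\<^bsub>C\<^esub> v = on_arr G g"
    using C.comp_assoc[OF v u Gg] uv C.comp_idt_right[OF Gg] by simp
  have gu: "on_arr G g \<bullet>\<^bsub>C\<^esub> u \<in> Homs C N (on_obj G S')" using u Gg by (rule C.comp_in_Homs)
  have "on_arr G g \<bullet>\<^bsub>C\<^esub> u \<noteq> zero_arr C N (on_obj G S')"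
    using guv C.comp_zero_left[OF v GS'] G_zero_arr_iff[OF g(1)] g(2) by auto
  moreover have "\<not> is_mono C (on_arr G g \<bullet>\<^bsub>C\<^esub> u)"
    using guv C.is_mono_comp[OF v gu] \<open>is_mono C v\<close> G_mono_iff[OF g(1)] g(3) by auto
  moreover have "iso_class C (on_obj G S') \<in> image_classes D C G \<M>"
    using S' by (auto simp: image_classes_def)
  ultimately show ?thesis using gu GS' by blast
qed

end

section \<open>Orthogonality and subobjects in the recollement\<close>

context recollement
begin

text \<open>The unprimed interpretations have a fully faithful right adjoint and provide the results
  on images. \<open>j_ust\<close> is left adjoint in \<open>j\<close> and right adjoint in
  \<open>j'\<close>, so it preserves epimorphisms by \<open>j.F_epi\<close> and monomorphisms by
  \<open>j'.G_mono\<close>.\<close>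

sublocale i: ff_adjunction X Y i_ust i_lst
  using adj_i_ust_i_lst ff_i_lst by unfold_locales

sublocale i': adjunction Y X i_lst i_ush
  using adj_i_lst_i_ush by unfold_locales

sublocale j': adjunction Z X j_lsh j_ust
  using adj_j_lsh_j_ust by unfold_locales

sublocale j: ff_adjunction X Z j_ust j_lst
  using adj_j_ust_j_lst ff_j_lst by unfold_locales

lemma j_ust_zero_iff:
  "B \<in> Obj X \<Longrightarrow>
    is_zero_object Z (on_obj j_ust B) \<longleftrightarrow> (\<exists>A \<in> Obj Y. isomorphic X B (on_obj i_lst A))"
  using image_eq_kernel by blast

lemma j_ust_i_lst_zero: "A \<in> Obj Y \<Longrightarrow> is_zero_object Z (on_obj j_ust (on_obj i_lst A))"
  using j_ust_zero_iff i.G_Obj X.isomorphic_refl by blast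

lemma Homs_kernel_j_lst:
  assumes "Q \<in> Obj X" "is_zero_object Z (on_obj j_ust Q)" "B \<in> Obj Z"
  shows "Homs X Q (on_obj j_lst B) = {zero_arr X Q (on_obj j_lst B)}"
  using j.Homs_zero_iff assms Z.Homs_zero_object by blast

text \<open>With A = i^! j_* B, transposition matches End(A) with Hom(i_* A, j_* B), which vanishes
  because j^* i_* = 0.\<close>

lemma i_ush_j_lst_zero:
  assumes B: "B \<in> Obj Z"
  shows "is_zero_object Y (on_obj i_ush (on_obj j_lst B))"
proof (rule Y.is_zero_objectI)
  show O: "on_obj i_ush (on_obj j_lst B) \<in> Obj Y" using B j.G_Obj i'.G_Obj by blast
  show "Homs Y (on_obj i_ush (on_obj j_lst B)) (on_obj i_ush (on_obj j_lst B))
    = {zero_arr Y (on_obj i_ush (on_obj j_lst B)) (on_obj i_ush (on_obj j_lst B))}"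
    using i'.Homs_zero_iff[OF O j.G_Obj[OF B]]
      Homs_kernel_j_lst[OF i.G_Obj[OF O] j_ust_i_lst_zero[OF O] B] by blast
qed

text \<open>Exactness of i^! enters the development through this lemma: it keeps i^! e epi, which
  makes i^! R a quotient of zero.\<close>

lemma Homs_j_lst_kernel:
  assumes exact: "exact_functor X Y i_ush"
    and B: "B \<in> Obj Z" and Q: "Q \<in> Obj X" "is_zero_object Z (on_obj j_ust Q)"
  shows "Homs X (on_obj j_lst B) Q = {zero_arr X (on_obj j_lst B) Q}"
proof -
  let ?J = "on_obj j_lst B"
  let ?P = "on_obj j_ust ?J"
  have J: "?J \<in> Obj X" and P: "?P \<in> Obj Z" using B j.G_Obj j.F_Obj by auto
  obtain \<epsilon> where \<epsilon>: "\<epsilon> \<in> Homs X (on_obj j_lsh ?P) ?J" "j'.transp ?P ?J \<epsilon> = idt Z ?P"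
    using Z.idt_in_Homs[OF P] J by (rule j'.ex_transp)
  obtain e where e: "is_cokernel X \<epsilon> e" using X.ex_cokernel \<epsilon>(1) by (auto simp: Homs_def)
  define R where "R = Cod X e"
  have He: "e \<in> Homs X ?J R" and e\<epsilon>: "e \<bullet>\<^bsub>X\<^esub> \<epsilon> = zero_arr X (on_obj j_lsh ?P) R"
    using X.is_cokernelD[OF e \<epsilon>(1)] by (auto simp: R_def)
  have R: "R \<in> Obj X" using He X.Homs_Obj by blast
  have epi: "is_epi X e" using e by (rule X.is_epi_cokernel)
  have je: "on_arr j_ust e \<in> Homs Z ?P (on_obj j_ust R)" using He by (rule j.F_Homs)
  have "on_arr j_ust e = zero_arr Z ?P (on_obj j_ust R)"
  proof -
    have z: "zero_arr X ?J R \<in> Homs X ?J R" using X.zero_in_Homs J R by blast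
    \<comment> \<open>Both sides are now composites with the counit \<epsilon>, whose transpose is
      the identity; transposing them compares j^* e with j^* 0.\<close>
    have "e \<bullet>\<^bsub>X\<^esub> \<epsilon> = zero_arr X ?J R \<bullet>\<^bsub>X\<^esub> \<epsilon>"
      using e\<epsilon> X.comp_zero_left[OF \<epsilon>(1) R] by simp
    then have "on_arr j_ust e \<bullet>\<^bsub>Z\<^esub> idt Z ?P = on_arr j_ust (zero_arr X ?J R) \<bullet>\<^bsub>Z\<^esub> idt Z ?P"
      using j'.transp_comp_left[OF P \<epsilon>(1) He] j'.transp_comp_left[OF P \<epsilon>(1) z] \<epsilon>(2) by simp
    then show ?thesis
      using Z.comp_idt_right[OF je] Z.comp_idt_right[OF j.F_Homs[OF z]] j.F_zero_arr[OF _ J R]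
      by simp
  qed
  then have "is_zero_object Z (on_obj j_ust R)"
    using Z.is_zero_object_if_zero_epi[OF je j.F_epi[OF He epi]] by simp
  then obtain A where A: "A \<in> Obj Y" "isomorphic X R (on_obj i_lst A)"
    using j_ust_zero_iff[OF R] by blast
  have ie: "on_arr i_ush e \<in> Homs Y (on_obj i_ush ?J) (on_obj i_ush R)"
    using He by (rule i'.G_Homs)
  have iR: "is_zero_object Y (on_obj i_ush R)"
  proof (rule Y.is_zero_object_if_zero_epi[OF ie])
    show "is_epi Y (on_arr i_ush e)"
      using exact_functor_epi[OF X.abelian_category_axioms Y.preadditive_category_axioms exact e] .
    show "on_arr i_ush e = zero_arr Y (on_obj i_ush ?J) (on_obj i_ush R)"
      using Y.Homs_zero_object(1)[OF i_ush_j_lst_zero[OF B] i'.G_Obj[OF R]] ie by blast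
  qed
  \<comment> \<open>By adjunction i^! R = 0 leaves only zero morphisms from i_* A to R, and the
    isomorphism between them is one of these.\<close>
  have homs: "Homs X (on_obj i_lst A) R = {zero_arr X (on_obj i_lst A) R}"
    using i'.Homs_zero_iff[OF A(1) R] Y.Homs_zero_object(2)[OF iR A(1)] by blast
  have "is_zero_object X R"
  proof -
    obtain u v where u: "u \<in> Homs X R (on_obj i_lst A)" and v: "v \<in> Homs X (on_obj i_lst A) R"
      and vu: "v \<bullet>\<^bsub>X\<^esub> u = idt X R"
      using A(2) by (rule X.isomorphicE)
    have "v = zero_arr X (on_obj i_lst A) R" using v homs by blast
    then show ?thesis
      using X.comp_zero_left[OF u R] vu R by (simp add: X.is_zero_object_iff)
  qed
  then have e0: "e = zero_arr X ?J R" using X.Homs_zero_object(2)[OF _ J] He by blast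
  have "f = zero_arr X ?J Q" if f: "f \<in> Homs X ?J Q" for f
  proof -
    \<comment> \<open>By adjunction Hom(j_! P, Q) matches Hom(P, j^* Q) = 0. So f kills \<epsilon>
      and factors through the cokernel e, which is zero.\<close>
    have "Homs X (on_obj j_lsh ?P) Q = {zero_arr X (on_obj j_lsh ?P) Q}"
      using j'.Homs_zero_iff[OF P Q(1)] Z.Homs_zero_object(2)[OF Q(2) P] by blast
    then have "f \<bullet>\<^bsub>X\<^esub> \<epsilon> = zero_arr X (on_obj j_lsh ?P) Q"
      using X.comp_in_Homs[OF \<epsilon>(1) f] by blast
    then obtain w where w: "w \<in> Homs X R Q" "w \<bullet>\<^bsub>X\<^esub> e = f"
      using X.is_cokernelD(3)[OF e \<epsilon>(1) f] by (auto simp: R_def)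
    then show ?thesis using e0 X.comp_zero_right[OF w(1) J] by simp
  qed
  then show ?thesis using X.zero_in_Homs[OF J Q(1)] by blast
qed

text \<open>The isomorphism is the unit \<eta> at \<open>N\<close>, recognised as a monomorphism
  with zero cokernel.\<close>

lemma subobject_j_lst:
  assumes exact: "exact_functor X Y i_ush" and B: "B \<in> Obj Z"
    and f: "f \<in> Homs X N (on_obj j_lst B)" "is_mono X f"
  shows "isomorphic X N (on_obj j_lst (on_obj j_ust N))"
proof -
  let ?Z = "on_obj j_ust N"
  let ?J = "on_obj j_lst ?Z"
  have N: "N \<in> Obj X" using f X.Homs_Obj by blast
  have Z: "?Z \<in> Obj Z" and J: "?J \<in> Obj X" using N j.F_Obj j.G_Obj by auto
  have Z1: "idt Z ?Z \<in> Homs Z ?Z ?Z" using Z by (rule Z.idt_in_Homs)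
  define \<eta> where "\<eta> = j.transp N ?Z (idt Z ?Z)"
  have \<eta>: "\<eta> \<in> Homs X N ?J" unfolding \<eta>_def by (rule j.transp_Homs[OF N Z1])
  obtain g where g: "g \<in> Homs Z ?Z B" "j.transp N B g = f" using f(1) B by (rule j.ex_transp)
  have "f = on_arr j_lst g \<bullet>\<^bsub>X\<^esub> \<eta>"
    using j.transp_comp_left[OF N Z1 g(1)] g Z.comp_idt_right[OF g(1)] by (simp add: \<eta>_def)
  then have mono: "is_mono X \<eta>" using X.is_mono_cancel[OF \<eta> j.G_Homs[OF g(1)]] f(2) by simp
  obtain q where q: "is_cokernel X \<eta> q" using X.ex_cokernel \<eta> by (auto simp: Homs_def)
  define Q where "Q = Cod X q"
  have Hq: "q \<in> Homs X ?J Q" and q\<eta>: "q \<bullet>\<^bsub>X\<^esub> \<eta> = zero_arr X N Q"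
    using X.is_cokernelD[OF q \<eta>] by (auto simp: Q_def)
  have Q: "Q \<in> Obj X" using Hq X.Homs_Obj by blast
  have jq: "on_arr j_ust q \<in> Homs Z (on_obj j_ust ?J) (on_obj j_ust Q)"
    using Hq by (rule j.F_Homs)
  obtain \<epsilon> where \<epsilon>: "\<epsilon> \<in> Homs Z (on_obj j_ust ?J) ?Z"
    "on_arr j_ust \<eta> \<bullet>\<^bsub>Z\<^esub> \<epsilon> = idt Z (on_obj j_ust ?J)"
    using N \<eta>_def by (rule j.counit_inverse)
  \<comment> \<open>Since j^* \<eta> has a right inverse, j^* q = 0 follows. As j^* q is also epi,
    its target vanishes, and q becomes a morphism from the image of j_* to an object killed by
    j^*.\<close>
  have "on_arr j_ust q \<bullet>\<^bsub>Z\<^esub> on_arr j_ust \<eta> = zero_arr Z ?Z (on_obj j_ust Q)"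
    using j.F_comp[OF \<eta> Hq] q\<eta> j.F_zero_arr[OF _ N Q] by simp
  then have "on_arr j_ust q = zero_arr Z (on_obj j_ust ?J) (on_obj j_ust Q)"
    using Z.comp_assoc[OF \<epsilon>(1) j.F_Homs[OF \<eta>] jq] \<epsilon>(2) Z.comp_idt_right[OF jq]
      Z.comp_zero_left[OF \<epsilon>(1) j.F_Obj[OF Q]] by simp
  then have "is_zero_object Z (on_obj j_ust Q)"
    using Z.is_zero_object_if_zero_epi[OF jq j.F_epi[OF Hq X.is_epi_cokernel[OF q]]] by simp
  then have "q = zero_arr X ?J Q" using Homs_j_lst_kernel[OF exact Z Q] Hq by blast
  then show ?thesis
    using X.isomorphic_if_mono_zero_cokernel[OF \<eta> mono q] by (simp add: Q_def)
qed

text \<open>As a right adjoint of j_!, the functor j^* preserves monomorphisms, and a monomorphism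
  into a zero object has zero source. The kernel of j^* is the essential image of i_*, which is
  thereby closed under subobjects.\<close>

lemma subobject_i_lst:
  assumes f: "f \<in> Homs X N M" "is_mono X f" and M: "is_zero_object Z (on_obj j_ust M)"
  shows "is_zero_object Z (on_obj j_ust N)"
proof (rule Z.is_zero_object_if_zero_mono)
  show jf: "on_arr j_ust f \<in> Homs Z (on_obj j_ust N) (on_obj j_ust M)" using f(1) by (rule j.F_Homs)
  show "is_mono Z (on_arr j_ust f)" using f by (rule j'.G_mono)
  show "on_arr j_ust f = zero_arr Z (on_obj j_ust N) (on_obj j_ust M)"
    using Z.Homs_zero_object(2)[OF M] jf Z.Homs_Obj by blast
qed

lemma image_i_lst_D:
  assumes "N \<in> Obj X" "iso_class X N \<in> image_classes Y X i_lst \<M>"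
  shows "is_zero_object Z (on_obj j_ust N)"
  using assms i.iso_class_in_image j_ust_zero_iff by blast

text \<open>The two vanishing results for j_* B pass to any object isomorphic to it by composing
  with the isomorphism and cancelling it again.\<close>

lemma zero_Homs_images:
  assumes exact: "exact_functor X Y i_ush"
    and N: "N \<in> Obj X" "iso_class X N \<in> image_classes Y X i_lst \<M>"
    and N': "N' \<in> Obj X" "iso_class X N' \<in> image_classes Z X j_lst \<M>'"
  shows "Homs X N N' = {zero_arr X N N'}" "Homs X N' N = {zero_arr X N' N}"
proof -
  have jN: "is_zero_object Z (on_obj j_ust N)" using N by (rule image_i_lst_D)
  obtain B where B: "B \<in> Obj Z" "isomorphic X N' (on_obj j_lst B)"
    using N' j.iso_class_in_image by blast
  obtain u v where u: "u \<in> Homs X N' (on_obj j_lst B)" and v: "v \<in> Homs X (on_obj j_lst B) N'"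
    and vu: "v \<bullet>\<^bsub>X\<^esub> u = idt X N'"
    using B(2) by (rule X.isomorphicE)
  have "f = zero_arr X N N'" if f: "f \<in> Homs X N N'" for f
  proof -
    have "u \<bullet>\<^bsub>X\<^esub> f = zero_arr X N (on_obj j_lst B)"
      using X.comp_in_Homs[OF f u] Homs_kernel_j_lst[OF N(1) jN B(1)] by blast
    then show ?thesis
      using X.comp_assoc[OF f u v] vu X.comp_idt_left[OF f] X.comp_zero_right[OF v N(1)] by simp
  qed
  then show "Homs X N N' = {zero_arr X N N'}" using X.zero_in_Homs N N' by blast
  have "f = zero_arr X N' N" if f: "f \<in> Homs X N' N" for f
  proof -
    have "f \<bullet>\<^bsub>X\<^esub> v = zero_arr X (on_obj j_lst B) N"
      using X.comp_in_Homs[OF v f] Homs_j_lst_kernel[OF exact B(1) N(1) jN] by blast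
    then show ?thesis
      using X.comp_assoc[OF u v f] vu X.comp_idt_right[OF f] X.comp_zero_left[OF u N(1)] by simp
  qed
  then show "Homs X N' N = {zero_arr X N' N}" using X.zero_in_Homs N N' by blast
qed

section \<open>The union of the two images\<close>

lemma disjoint_images:
  assumes exact: "exact_functor X Y i_ush" and \<M>: "monobrick Y \<M>"
  shows "image_classes Y X i_lst \<M> \<inter> image_classes Z X j_lst \<M>' = {}"
proof (rule ccontr)
  assume "\<not> ?thesis"
  then obtain c where c: "c \<in> image_classes Y X i_lst \<M>" "c \<in> image_classes Z X j_lst \<M>'"
    by blast
  then obtain S where S: "c = iso_class X S" "is_brick X S"
    using i.image_classes_subset_bricks[OF \<M>] by blast
  then have "S \<in> Obj X" by (simp add: is_brick_def)
  \<comment> \<open>A common class lets \<open>S\<close> play both roles in the orthogonality, so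
    even its identity is zero.\<close>
  then have "idt X S = zero_arr X S S"
    using zero_Homs_images(1)[OF exact, of S \<M> S \<M>'] c S X.idt_in_Homs by blast
  then show False using S(2) by (simp add: X.is_brick_iff)
qed

text \<open>Two objects from the same image are covered by \<open>zero_or_mono_image\<close>;
  between different images every morphism is zero.\<close>

lemma monobrick_images:
  assumes exact: "exact_functor X Y i_ush" and \<M>: "monobrick Y \<M>" "monobrick Z \<M>'"
  shows "monobrick X (image_classes Y X i_lst \<M> \<union> image_classes Z X j_lst \<M>')"
  using i.image_classes_subset_bricks[OF \<M>(1)] j.image_classes_subset_bricks[OF \<M>(2)]
    i.zero_or_mono_image[OF \<M>(1)] j.zero_or_mono_image[OF \<M>(2)] zero_Homs_images[OF exact]
  unfolding monobrick_def by (auto; blast)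

text \<open>Closure under subobjects puts \<open>N\<close> into the same essential image as
  \<open>M\<close>, so closedness of that one monobrick already supplies M'.\<close>

lemma cofinally_closed_images:
  assumes exact: "exact_functor X Y i_ush"
    and \<M>: "cofinally_closed_monobrick Y \<M>" "cofinally_closed_monobrick Z \<M>'"
  shows "cofinally_closed_monobrick X (image_classes Y X i_lst \<M> \<union> image_classes Z X j_lst \<M>')"
  unfolding cofinally_closed_monobrick_def
proof (intro conjI allI impI)
  show "monobrick X (image_classes Y X i_lst \<M> \<union> image_classes Z X j_lst \<M>')"
    using monobrick_images[OF exact] \<M> by (simp add: cofinally_closed_monobrick_def)
  fix N M f
  assume *: "is_brick X N \<and> iso_class X N \<notin> image_classes Y X i_lst \<M> \<union> image_classes Z X j_lst \<M>'
    \<and> M \<in> Obj X \<and> iso_class X M \<in> image_classes Y X i_lst \<M> \<union> image_classes Z X j_lst \<M>'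
    \<and> f \<in> Homs X N M \<and> is_mono X f"
  then have N: "is_brick X N" "iso_class X N \<notin> image_classes Y X i_lst \<M>"
      "iso_class X N \<notin> image_classes Z X j_lst \<M>'"
    and M: "M \<in> Obj X" and f: "f \<in> Homs X N M" "is_mono X f" by auto
  have NO: "N \<in> Obj X" using f X.Homs_Obj by blast
  from * consider (i) "iso_class X M \<in> image_classes Y X i_lst \<M>"
    | (j) "iso_class X M \<in> image_classes Z X j_lst \<M>'" by blast
  then show "\<exists>M' \<in> Obj X. iso_class X M' \<in> image_classes Y X i_lst \<M> \<union> image_classes Z X j_lst \<M>' \<and>
    (\<exists>g \<in> Homs X N M'. g \<noteq> zero_arr X N M' \<and> \<not> is_mono X g)"
  proof cases
    case i
    then obtain A where "A \<in> Obj Y" "isomorphic X N (on_obj i_lst A)"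
      using image_i_lst_D[OF M] subobject_i_lst[OF f] j_ust_zero_iff[OF NO] by blast
    then show ?thesis using i.cofinally_closed_image[OF \<M>(1) N(1,2) f i] by blast
  next
    case j
    then obtain B where B: "B \<in> Obj Z" "isomorphic X M (on_obj j_lst B)"
      using j.iso_class_in_image[OF M] by blast
    then obtain u v where u: "u \<in> Homs X M (on_obj j_lst B)" and v: "v \<in> Homs X (on_obj j_lst B) M"
      and "v \<bullet>\<^bsub>X\<^esub> u = idt X M"
      by (blast elim: X.isomorphicE)
    \<comment> \<open>\<open>subobject_j_lst\<close> needs a target of the form j_* B, so
      \<open>f\<close> is followed by the isomorphism from \<open>M\<close>.\<close>
    then have "is_mono X (u \<bullet>\<^bsub>X\<^esub> f)"
      using X.is_mono_comp[OF f(1) u f(2)] X.is_mono_if_retraction by blast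
    then have "isomorphic X N (on_obj j_lst (on_obj j_ust N))"
      using subobject_j_lst[OF exact B(1) X.comp_in_Homs[OF f(1) u]] by blast
    then show ?thesis
      using j.cofinally_closed_image[OF \<M>(2) N(1,3) f j j.F_Obj[OF NO]] by blast
  qed
qed

end

text \<open>The disjoint union is rendered as an empty intersection together with a union of sets of
  isomorphism classes.\<close>

theorem theorem3p7:
  fixes \<X> :: "('ox, 'mx, 'ex) add_cat_scheme"
    and \<Y> :: "('oy, 'my, 'ey) add_cat_scheme"
    and \<Z> :: "('oz, 'mz, 'ez) add_cat_scheme"
    and i_ust i_ush :: "('ox, 'mx, 'oy, 'my) funct"
    and i_lst :: "('oy, 'my, 'ox, 'mx) funct"
    and j_ust :: "('ox, 'mx, 'oz, 'mz) funct"
    and j_lsh j_lst :: "('oz, 'mz, 'ox, 'mx) funct"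
    and \<M>\<^sub>Y :: "'oy set set"
    and \<M>\<^sub>Z :: "'oz set set"
  assumes "length_abelian_category \<X>"
    and "length_abelian_category \<Y>"
    and "length_abelian_category \<Z>"
    and "recollement \<Y> \<X> \<Z> i_ust i_lst i_ush j_lsh j_ust j_lst"
    and "cofinally_closed_monobrick \<Y> \<M>\<^sub>Y"
    and "cofinally_closed_monobrick \<Z> \<M>\<^sub>Z"
    and "exact_functor \<X> \<Y> i_ush"
  shows "image_classes \<Y> \<X> i_lst \<M>\<^sub>Y \<inter> image_classes \<Z> \<X> j_lst \<M>\<^sub>Z = {}
    \<and> cofinally_closed_monobrick \<X>
        (image_classes \<Y> \<X> i_lst \<M>\<^sub>Y \<union> image_classes \<Z> \<X> j_lst \<M>\<^sub>Z)"
proof -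
  interpret recollement \<Y> \<X> \<Z> i_ust i_lst i_ush j_lsh j_ust j_lst by fact
  show ?thesis
    using disjoint_images cofinally_closed_images assms(5-7)
    by (auto simp: cofinally_closed_monobrick_def[of \<Y>])
qed

end
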